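(* Fix $0<\eta<\frac12$ and, for every $n$, let $p=n^{-1/2+\eta}$ and $\mathcal{Y}\sim Y(n,p)$. Then asymptotically almost surely (with probability tending to $1$ as $n\to\infty$), $h_1(\mathcal{Y},\mathrm{Sym})\ge\frac{\eta}{42}$.
   Context: Random model: $\mathcal{Y}\sim Y(n,p)$ is the random $2$-dimensional (Linial--Meshulam) simplicial complex with vertex set $[n]=\{1,\dots,n\}$, containing all $\binom n2$ edges, in which each of the $\binom n3$ triangles is included independently with probability $p$. Cochains with permutation coefficients: let $\mathcal{Y}$ be a finite $2$-dimensional simplicial complex. A $1$-cochain with $\mathrm{Sym}(N)$ coefficients is a function $\alpha$ from the oriented edges of $\mathcal{Y}$ to $\mathrm{Sym}(N)$ with $\alpha(yx)=\alpha(xy)^{-1}$. Its coboundary is defined on oriented triangles $xyz$ of $\mathcal{Y}$ by $\delta\alpha(xyz)=\alpha(xy)\alpha(yz)\alpha(zx)$. It is a $1$-cocycle if $\delta\alpha\equiv\mathrm{Id}$. Let $C^1(\mathcal{Y},\mathrm{Sym})$ (resp. $Z^1(\mathcal{Y},\mathrm{Sym})$) be the disjoint union over all $N\ge 2$ of the sets of $1$-cochains (resp. $1$-cocycles) with $\mathrm{Sym}(N)$ coefficients. Metric: for $\sigma\in\mathrm{Sym}(n)$, $\tau\in\mathrm{Sym}(N)$ with $N\ge n$, $d_h(\sigma,\tau)=d_h(\tau,\sigma)=1-\frac{|\{i\in[n]\,:\,\sigma(i)=\tau(i)\}|}{N}$. Measures: $\mu_2$ is the uniform probability measure on the triangles of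 $\mathcal{Y}$, and $\mu_1$ is the probability measure on edges with $\mu_1(e)$ proportional to the number of triangles of $\mathcal{Y}$ containing $e$. Put $d(\alpha,\beta)=\mathbb{E}_{e\sim\mu_1}[d_h(\alpha(e),\beta(e))]$, $\|\delta\alpha\|=\mathbb{E}_{\Delta\sim\mu_2}[d_h(\delta\alpha(\Delta),\mathrm{Id})]$ (these do not depend on chosen orientations), and $d(\alpha,Z^1(\mathcal{Y},\mathrm{Sym}))=\inf_{\varphi\in Z^1(\mathcal{Y},\mathrm{Sym})}d(\alpha,\varphi)$. Cocycle Cheeger constant: $h_1(\mathcal{Y},\mathrm{Sym})=\inf\Big\{\frac{\|\delta\alpha\|}{d(\alpha,Z^1(\mathcal{Y},\mathrm{Sym}))} : \alpha\in C^1(\mathcal{Y},\mathrm{Sym}),\ \|\delta\alpha\|\ne 0\Big\}$ (with $\inf\emptyset=\infty$). *)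

theory Defs
  imports "HOL-Probability.Probability" "HOL-Combinatorics.Permutations"
begin

text \<open>
  A simplicial complex is given by its set of simplices (finite nonempty sets of vertices).
  Vertices are linearly ordered; the order only serves to pick one orientation of each edge
  and triangle in the averages \<open>cochain_dist\<close> and \<open>cobdry_norm\<close> below.
\<close>

definition edges :: "'v set set \<Rightarrow> 'v set set" where
  "edges Y = {e \<in> Y. card e = 2}"

definition triangles :: "'v set set \<Rightarrow> 'v set set" where
  "triangles Y = {t \<in> Y. card t = 3}"

definition oriented_edges :: "'v set set \<Rightarrow> ('v \<times> 'v) set" where
  "oriented_edges Y = {(x, y). x \<noteq> y \<and> {x, y} \<in> Y}"

definition oriented_triangles :: "'v set set \<Rightarrow> ('v \<times> 'v \<times> 'v) set" where
  "oriented_triangles Y =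
     {(x, y, z). x \<noteq> y \<and> y \<noteq> z \<and> z \<noteq> x \<and> {x, y, z} \<in> Y}"


subsection \<open>Cochains with permutation coefficients\<close>

text \<open>\<open>Sym(N)\<close> is the set of permutations of \<open>{1..N}\<close>, extended by the identity to \<open>nat\<close>,
  with composition as multiplication.\<close>

type_synonym 'v cochain = "'v \<times> 'v \<Rightarrow> nat \<Rightarrow> nat"

definition cochains :: "'v set set \<Rightarrow> nat \<Rightarrow> 'v cochain set" where
  "cochains Y N =
     {\<alpha> \<in> oriented_edges Y \<rightarrow>\<^sub>E {\<sigma>. \<sigma> permutes {1..N}}.
        \<forall>(x, y) \<in> oriented_edges Y. \<alpha> (y, x) = inv (\<alpha> (x, y))}"

definition cobdry :: "'v cochain \<Rightarrow> 'v \<times> 'v \<times> 'v \<Rightarrow> nat \<Rightarrow> nat" where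
  "cobdry \<alpha> = (\<lambda>(x, y, z). \<alpha> (x, y) \<circ> \<alpha> (y, z) \<circ> \<alpha> (z, x))"

definition cocycles :: "'v set set \<Rightarrow> nat \<Rightarrow> 'v cochain set" where
  "cocycles Y N = {\<alpha> \<in> cochains Y N. \<forall>t \<in> oriented_triangles Y. cobdry \<alpha> t = id}"

text \<open>The disjoint unions over all \<open>N \<ge> 2\<close>: elements are pairs \<open>(N, \<alpha>)\<close>.\<close>

definition C1_Sym :: "'v set set \<Rightarrow> (nat \<times> 'v cochain) set" where
  "C1_Sym Y = (SIGMA N:{2..}. cochains Y N)"

definition Z1_Sym :: "'v set set \<Rightarrow> (nat \<times> 'v cochain) set" where
  "Z1_Sym Y = (SIGMA N:{2..}. cocycles Y N)"


subsection \<open>Metrics and the cocycle Cheeger constant\<close>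

text \<open>The degree \<open>N\<close> must be passed along with the permutation, because a permutation of
  \<open>{1..N}\<close> is as a function also one of \<open>{1..M}\<close> for \<open>M \<ge> N\<close>.\<close>

definition d_h :: "nat \<times> (nat \<Rightarrow> nat) \<Rightarrow> nat \<times> (nat \<Rightarrow> nat) \<Rightarrow> real" where
  "d_h = (\<lambda>(n, \<sigma>) (N, \<tau>).
     1 - real (card {i \<in> {1..min n N}. \<sigma> i = \<tau> i}) / real (max n N))"

definition mu1 :: "'v set set \<Rightarrow> 'v set \<Rightarrow> real" where
  "mu1 Y e = real (card {t \<in> triangles Y. e \<subseteq> t})
      / (\<Sum>e' \<in> edges Y. real (card {t \<in> triangles Y. e' \<subseteq> t}))"

definition cochain_dist ::
  "('v::linorder) set set \<Rightarrow> nat \<times> 'v cochain \<Rightarrow> nat \<times> 'v cochain \<Rightarrow> real" where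
  "cochain_dist Y = (\<lambda>(N, \<alpha>) (M, \<beta>).
     \<Sum>(x, y) \<in> {(x, y) \<in> oriented_edges Y. x < y}.
        mu1 Y {x, y} * d_h (N, \<alpha> (x, y)) (M, \<beta> (x, y)))"

text \<open>If there are no triangles (so that the uniform measure on them does not exist), this
  is \<open>0 / 0 = 0\<close>.\<close>

definition cobdry_norm :: "('v::linorder) set set \<Rightarrow> nat \<times> 'v cochain \<Rightarrow> real" where
  "cobdry_norm Y = (\<lambda>(N, \<alpha>).
     (\<Sum>(x, y, z) \<in> {(x, y, z) \<in> oriented_triangles Y. x < y \<and> y < z}.
        d_h (N, cobdry \<alpha> (x, y, z)) (N, id)) / real (card (triangles Y)))"

definition dist_Z1 :: "('v::linorder) set set \<Rightarrow> nat \<times> 'v cochain \<Rightarrow> real" where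
  "dist_Z1 Y \<alpha> = (INF \<phi> \<in> Z1_Sym Y. cochain_dist Y \<alpha> \<phi>)"

text \<open>In \<^typ>\<open>ereal\<close> the infimum of the empty set is \<open>\<infinity>\<close>, and so is a positive number
  divided by \<open>0\<close>.\<close>

definition h1_Sym :: "('v::linorder) set set \<Rightarrow> ereal" where
  "h1_Sym Y = (INF \<alpha> \<in> {\<alpha> \<in> C1_Sym Y. cobdry_norm Y \<alpha> \<noteq> 0}.
     ereal (cobdry_norm Y \<alpha>) / ereal (dist_Z1 Y \<alpha>))"


subsection \<open>Independence of the chosen orientations\<close>

lemma d_h_inv:
  assumes "\<sigma> permutes {1..n}" "\<tau> permutes {1..N}"
  shows "d_h (n, inv \<sigma>) (N, inv \<tau>) = d_h (n, \<sigma>) (N, \<tau>)"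
proof -
  have gen: "card {i \<in> {1..min n N}. \<sigma> i = \<tau> i} \<le> card {i \<in> {1..min n N}. inv \<sigma> i = inv \<tau> i}"
    if s: "\<sigma> permutes {1..n}" and t: "\<tau> permutes {1..N}" for \<sigma> \<tau> :: "nat \<Rightarrow> nat"
  proof (rule card_inj_on_le[of \<sigma>])
    show "inj_on \<sigma> {i \<in> {1..min n N}. \<sigma> i = \<tau> i}"
      using permutes_inj[OF s] by (rule inj_on_subset) simp
    show "\<sigma> ` {i \<in> {1..min n N}. \<sigma> i = \<tau> i} \<subseteq> {i \<in> {1..min n N}. inv \<sigma> i = inv \<tau> i}"
    proof (intro subsetI, elim imageE)
      fix j i assume j: "j = \<sigma> i" and i: "i \<in> {i \<in> {1..min n N}. \<sigma> i = \<tau> i}"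
      have "\<sigma> i \<in> {1..n}" using i permutes_in_image[OF s, of i] by simp
      moreover have "\<tau> i \<in> {1..N}" using i permutes_in_image[OF t, of i] by simp
      moreover have "inv \<sigma> j = i" "inv \<tau> j = i"
        using i j permutes_inverses(2)[OF s, of i] permutes_inverses(2)[OF t, of i] by simp_all
      ultimately show "j \<in> {i \<in> {1..min n N}. inv \<sigma> i = inv \<tau> i}"
        using i j by simp
    qed
  qed simp
  have "card {i \<in> {1..min n N}. inv \<sigma> i = inv \<tau> i} = card {i \<in> {1..min n N}. \<sigma> i = \<tau> i}"
    using gen[OF assms] gen[OF permutes_inv[OF assms(1)] permutes_inv[OF assms(2)]]
      permutes_inv_inv[OF assms(1)] permutes_inv_inv[OF assms(2)] by simp
  then show ?thesis by (simp add: d_h_def)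
qed

lemma d_h_id_conj:
  assumes r: "\<rho> permutes {1..N}" and s: "\<sigma> permutes {1..N}"
  shows "d_h (N, inv \<rho> \<circ> \<sigma> \<circ> \<rho>) (N, id) = d_h (N, \<sigma>) (N, id)"
proof -
  have "bij_betw \<rho> {i \<in> {1..N}. (inv \<rho> \<circ> \<sigma> \<circ> \<rho>) i = i} {i \<in> {1..N}. \<sigma> i = i}"
  proof (rule bij_betw_byWitness[where f' = "inv \<rho>"])
    show "\<rho> ` {i \<in> {1..N}. (inv \<rho> \<circ> \<sigma> \<circ> \<rho>) i = i} \<subseteq> {i \<in> {1..N}. \<sigma> i = i}"
      using permutes_in_image[OF r] permutes_inverses[OF r]
      by (auto simp del: atLeastAtMost_iff) (metis)
    show "inv \<rho> ` {i \<in> {1..N}. \<sigma> i = i} \<subseteq> {i \<in> {1..N}. (inv \<rho> \<circ> \<sigma> \<circ> \<rho>) i = i}"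
      using permutes_in_image[OF permutes_inv[OF r]] permutes_inverses[OF r]
      by (auto simp del: atLeastAtMost_iff)
  qed (use permutes_inverses[OF r] in auto)
  then show ?thesis by (simp add: d_h_def bij_betw_same_card)
qed

lemma d_h_edge_orientation:
  assumes "\<alpha> \<in> cochains Y N" "\<beta> \<in> cochains Y M" "(x, y) \<in> oriented_edges Y"
  shows "d_h (N, \<alpha> (y, x)) (M, \<beta> (y, x)) = d_h (N, \<alpha> (x, y)) (M, \<beta> (x, y))"
proof -
  have "\<alpha> (x, y) permutes {1..N}" "\<beta> (x, y) permutes {1..M}"
    using assms by (auto simp: cochains_def PiE_iff)
  moreover have "\<alpha> (y, x) = inv (\<alpha> (x, y))" "\<beta> (y, x) = inv (\<beta> (x, y))"
    using assms by (auto simp: cochains_def)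
  ultimately show ?thesis using d_h_inv by metis
qed

lemma d_h_cobdry_orientation:
  assumes a: "\<alpha> \<in> cochains Y N"
    and e: "(x, y) \<in> oriented_edges Y" "(y, z) \<in> oriented_edges Y" "(z, x) \<in> oriented_edges Y"
  shows "d_h (N, cobdry \<alpha> (y, z, x)) (N, id) = d_h (N, cobdry \<alpha> (x, y, z)) (N, id)"
    and "d_h (N, cobdry \<alpha> (x, z, y)) (N, id) = d_h (N, cobdry \<alpha> (x, y, z)) (N, id)"
proof -
  have p: "\<alpha> (x, y) permutes {1..N}" "\<alpha> (y, z) permutes {1..N}" "\<alpha> (z, x) permutes {1..N}"
    using assms by (auto simp: cochains_def PiE_iff)
  have i: "\<alpha> (y, x) = inv (\<alpha> (x, y))" "\<alpha> (z, y) = inv (\<alpha> (y, z))" "\<alpha> (x, z) = inv (\<alpha> (z, x))"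
    using assms by (auto simp: cochains_def)
  have q: "cobdry \<alpha> (x, y, z) permutes {1..N}"
    using p by (simp add: cobdry_def permutes_compose)
  have "cobdry \<alpha> (y, z, x) = inv (\<alpha> (x, y)) \<circ> cobdry \<alpha> (x, y, z) \<circ> \<alpha> (x, y)"
    using permutes_inverses[OF p(1)] by (auto simp: cobdry_def fun_eq_iff)
  then show "d_h (N, cobdry \<alpha> (y, z, x)) (N, id) = d_h (N, cobdry \<alpha> (x, y, z)) (N, id)"
    using d_h_id_conj[OF p(1) q] by simp
  have "cobdry \<alpha> (x, z, y) = inv (cobdry \<alpha> (x, y, z))"
    using p by (simp add: cobdry_def i o_inv_distrib permutes_bij bij_comp o_assoc)
  then show "d_h (N, cobdry \<alpha> (x, z, y)) (N, id) = d_h (N, cobdry \<alpha> (x, y, z)) (N, id)"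
    using d_h_inv[OF q permutes_id] by simp
qed


subsection \<open>The Linial--Meshulam model\<close>

definition all_triangles :: "nat \<Rightarrow> nat set set" where
  "all_triangles n = {t. t \<subseteq> {1..n} \<and> card t = 3}"

definition complete_skeleton :: "nat \<Rightarrow> nat set set" where
  "complete_skeleton n = {s. s \<subseteq> {1..n} \<and> card s \<in> {1, 2}}"

definition linial_meshulam :: "nat \<Rightarrow> real \<Rightarrow> nat set set pmf" where
  "linial_meshulam n p =
     map_pmf (\<lambda>f. complete_skeleton n \<union> {t \<in> all_triangles n. f t})
       (Pi_pmf (all_triangles n) False (\<lambda>_. bernoulli_pmf p))"

end

theory Submission
  imports Defs "HOL-Real_Asymp.Real_Asymp"
begin

text \<open>
  Call the normalised Hamming distance of \<open>\<delta>\<alpha>(xyz)\<close> from the identity the defect of \<open>xyz\<close>, also for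
  the triples that are not triangles of \<open>Y\<close>. Coning \<open>\<alpha>\<close> off from a vertex \<open>v\<close> gives a cocycle whose
  distance from \<open>\<alpha>\<close> at \<open>xy\<close> is the defect of \<open>xyv\<close>, so averaging over \<open>v\<close> reduces the claim to bounding
  the mean defect of all triples by \<open>O(1/\<eta>)\<close> times the mean defect of the triangles of \<open>Y\<close>.

  The defect of \<open>xyz\<close> is at most the sum of the defects of \<open>xyu\<close>, \<open>xzu\<close> and \<open>yzu\<close>. For fixed \<open>xy\<close>, move
  \<open>z\<close> along the edges \<open>zu\<close> for which both \<open>xzu\<close> and \<open>yzu\<close> lie in \<open>Y\<close>; this graph has degrees about
  \<open>n p\<^sup>2 = n powr (2 \<eta>)\<close>. After \<open>k\<close> steps, where \<open>k\<close> is minimal with \<open>(2 k + 1) \<eta> > 1 / 2\<close>, there are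
  about \<open>(n p\<^sup>2) ^ k\<close> endpoints, enough for the expected proportion \<open>p\<close> of them to form a triangle
  with \<open>xy\<close>. This fills \<open>xyz\<close> with \<open>2 k + 1 = O(1/\<eta>)\<close> triangles of \<open>Y\<close>, in about the same number of ways
  for every \<open>xyz\<close>. The number of fillings that use a given triangle is bounded inductively: restricting
  to paths without repetition makes every count a sum of independent indicators whose weights do not
  involve the triangles that the indicators belong to, so a Chernoff bound applies conditionally.
\<close>

section \<open>Weighted Chernoff bounds for random subsets\<close>

definition random_subset :: "'a set \<Rightarrow> real \<Rightarrow> 'a set pmf" where
  "random_subset A p =
     map_pmf (\<lambda>f. {t \<in> A. f t}) (Pi_pmf A False (\<lambda>_. bernoulli_pmf p))"

text \<open>Exposure in two independent rounds. This is what permits conditioning on everything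
  outside the family that is summed over.\<close>

lemma random_subset_union:
  assumes "finite A" "finite B" "A \<inter> B = {}"
  shows "random_subset (A \<union> B) p =
    bind_pmf (random_subset A p) (\<lambda>S. map_pmf (\<lambda>S'. S \<union> S') (random_subset B p))"
proof -
  have eq: "{t \<in> A \<union> B. if t \<in> A then f t else g t} = {t \<in> A. f t} \<union> {t \<in> B. g t}" for f g
    using assms(3) by auto
  have "random_subset (A \<union> B) p = map_pmf (\<lambda>(f, g). {t \<in> A \<union> B. if t \<in> A then f t else g t})
      (pair_pmf (Pi_pmf A False (\<lambda>_. bernoulli_pmf p)) (Pi_pmf B False (\<lambda>_. bernoulli_pmf p)))"
    by (simp add: random_subset_def Pi_pmf_union[OF assms] map_pmf_comp case_prod_beta')
  also have "\<dots> = bind_pmf (random_subset A p) (\<lambda>S. map_pmf (\<lambda>S'. S \<union> S') (random_subset B p))"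
    unfolding eq
    by (simp add: random_subset_def pair_pmf_def map_pmf_def bind_assoc_pmf bind_return_pmf)
  finally show ?thesis .
qed

text \<open>For negative \<open>x\<close> this follows from \<open>exp x \<le> 1 / (1 - x)\<close>
  and \<open>(1 + x + x^2) * (1 - x) = 1 - x^3 \<ge> 1\<close>.\<close>

lemma exp_le_quadratic:
  fixes x :: real
  assumes "-1 \<le> x" "x \<le> 1"
  shows "exp x \<le> 1 + x + x\<^sup>2"
proof (cases "0 \<le> x")
  case True
  then show ?thesis using assms exp_bound by simp
next
  case False
  have "exp x * (1 - x) \<le> exp x * exp (- x)"
    using exp_ge_add_one_self[of "-x"] by (intro mult_left_mono) auto
  then have "exp x \<le> 1 / (1 - x)"
    using False by (simp add: exp_minus field_simps)
  also have "\<dots> \<le> 1 + x + x\<^sup>2"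
  proof -
    have "x ^ 3 \<le> 0" using False by (simp add: power_le_zero_eq)
    then have "1 \<le> (1 + x + x\<^sup>2) * (1 - x)"
      by (simp add: algebra_simps power2_eq_square power3_eq_cube)
    then show ?thesis using False by (simp add: divide_le_eq)
  qed
  finally show ?thesis .
qed

text \<open>Independence factorises the expectation, and \<open>a t \<le> 1\<close> makes the
  quadratic term of each factor linear in \<open>a t\<close>, so that only the total weight
  enters.\<close>

lemma weighted_bernoulli_mgf_le:
  fixes a :: "'a \<Rightarrow> real"
  assumes "finite B" "0 \<le> p" "p \<le> 1" "\<And>t. t \<in> B \<Longrightarrow> 0 \<le> a t \<and> a t \<le> 1" "\<bar>s\<bar> \<le> 1"
  shows "measure_pmf.expectation (Pi_pmf B False (\<lambda>_. bernoulli_pmf p))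
      (\<lambda>f. exp (s * (\<Sum>t\<in>B. a t * of_bool (f t)))) \<le> exp (p * (s + s\<^sup>2) * (\<Sum>t\<in>B. a t))"
proof -
  have "measure_pmf.expectation (Pi_pmf B False (\<lambda>_. bernoulli_pmf p))
      (\<lambda>f. exp (s * (\<Sum>t\<in>B. a t * of_bool (f t))))
    = measure_pmf.expectation (Pi_pmf B False (\<lambda>_. bernoulli_pmf p))
      (\<lambda>f. \<Prod>t\<in>B. exp (s * (a t * of_bool (f t))))"
    using assms(1) by (simp add: exp_sum sum_distrib_left del: sum_mult_of_bool_eq)
  also have "\<dots> = (\<Prod>t\<in>B. measure_pmf.expectation (bernoulli_pmf p) (\<lambda>b. exp (s * (a t * of_bool b))))"
    by (intro expectation_prod_Pi_pmf integrable_measure_pmf_finite) (auto simp: assms)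
  also have "\<dots> = (\<Prod>t\<in>B. 1 + p * (exp (s * a t) - 1))"
    using assms by (intro prod.cong) (auto simp: algebra_simps)
  also have "\<dots> \<le> (\<Prod>t\<in>B. exp (p * (s + s\<^sup>2) * a t))"
  proof (intro prod_mono conjI)
    fix t assume t: "t \<in> B"
    have a: "0 \<le> a t" "a t \<le> 1" using assms(4)[OF t] by auto
    have sa: "\<bar>s * a t\<bar> \<le> 1" using a assms(5) by (simp add: abs_mult mult_le_one)
    have "exp (s * a t) - 1 \<le> s * a t + (s * a t)\<^sup>2"
      using exp_le_quadratic[of "s * a t"] sa by linarith
    also have "(s * a t)\<^sup>2 \<le> s\<^sup>2 * a t"
      using a mult_left_mono[of "(a t)\<^sup>2" "a t" "s\<^sup>2"] mult_left_le[of "a t" "a t"]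
      by (simp add: power_mult_distrib power2_eq_square[of "a t"])
    finally have "p * (exp (s * a t) - 1) \<le> p * ((s + s\<^sup>2) * a t)"
      using assms(2) by (intro mult_left_mono) (auto simp: algebra_simps)
    then show "1 + p * (exp (s * a t) - 1) \<le> exp (p * (s + s\<^sup>2) * a t)"
      using exp_ge_add_one_self[of "p * (s + s\<^sup>2) * a t"] unfolding mult.assoc by linarith
    have "p * (1 - exp (s * a t)) \<le> p * 1"
      using assms(2) by (intro mult_left_mono) auto
    then show "0 \<le> 1 + p * (exp (s * a t) - 1)"
      using assms(3) by (simp add: right_diff_distrib)
  qed
  also have "\<dots> = exp (p * (s + s\<^sup>2) * (\<Sum>t\<in>B. a t))"
    using assms(1) by (simp add: exp_sum sum_distrib_left)
  finally show ?thesis .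
qed

text \<open>Markov's inequality for the exponential moment. Positive \<open>s\<close> gives upper
  tails, negative \<open>s\<close> lower tails.\<close>

lemma weighted_bernoulli_tail:
  fixes a :: "'a \<Rightarrow> real"
  assumes "finite B" "0 \<le> p" "p \<le> 1" "\<And>t. t \<in> B \<Longrightarrow> 0 \<le> a t \<and> a t \<le> 1" "\<bar>s\<bar> \<le> 1"
  shows "measure_pmf.prob (Pi_pmf B False (\<lambda>_. bernoulli_pmf p))
      {f. s * c \<le> s * (\<Sum>t\<in>B. a t * of_bool (f t))} \<le> exp (p * (s + s\<^sup>2) * (\<Sum>t\<in>B. a t) - s * c)"
proof -
  let ?P = "Pi_pmf B False (\<lambda>_. bernoulli_pmf p)"
  let ?X = "\<lambda>f. exp (s * (\<Sum>t\<in>B. a t * of_bool (f t)))"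
  have fin: "finite (set_pmf ?P)"
    using assms(1) by (subst set_Pi_pmf) auto
  have "measure_pmf.prob ?P {f. s * c \<le> s * (\<Sum>t\<in>B. a t * of_bool (f t))}
      = measure_pmf.prob ?P {f \<in> space (measure_pmf ?P). exp (s * c) \<le> ?X f}"
    by simp
  also have "\<dots> \<le> measure_pmf.expectation ?P ?X / exp (s * c)"
    by (rule integral_Markov_inequality_measure[where A="{}"])
       (auto intro!: integrable_measure_pmf_finite fin)
  also have "\<dots> \<le> exp (p * (s + s\<^sup>2) * (\<Sum>t\<in>B. a t)) / exp (s * c)"
    by (intro divide_right_mono weighted_bernoulli_mgf_le assms) auto
  finally show ?thesis by (simp add: exp_diff)
qed

lemma prob_bind_pmf_le:
  assumes "\<And>x. measure_pmf.prob (f x) E \<le> c"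
  shows "measure_pmf.prob (bind_pmf M f) E \<le> c"
proof -
  have c: "0 \<le> c" using assms[of undefined] measure_nonneg order_trans by blast
  have "emeasure (bind_pmf M f) E = (\<integral>\<^sup>+ x. emeasure (f x) E \<partial>M)" by simp
  also have "\<dots> \<le> (\<integral>\<^sup>+ x. ennreal c \<partial>M)"
    using assms by (intro nn_integral_mono) (simp add: measure_pmf.emeasure_eq_measure ennreal_leI)
  also have "\<dots> = ennreal c" by simp
  finally show ?thesis using c by (simp add: measure_pmf.emeasure_eq_measure)
qed

text \<open>The weights may depend on the random set, but only outside the part that is summed over;
  conditionally on that outside part this is Chernoff's bound.\<close>

lemma random_subset_weighted_tail:
  fixes a :: "'a set \<Rightarrow> 'b \<Rightarrow> real"
  assumes A: "finite A" and p: "0 \<le> p" "p \<le> 1" and U: "finite U" "inj_on \<tau> U" "\<tau> ` U \<subseteq> A"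
    and indep: "\<And>T u. T \<subseteq> A \<Longrightarrow> u \<in> U \<Longrightarrow> a (T - \<tau> ` U) u = a T u"
    and M: "0 < M" and s: "\<bar>s\<bar> \<le> 1"
    and imp: "\<And>T. T \<subseteq> A \<Longrightarrow> T \<in> E \<Longrightarrow> (\<forall>u\<in>U. 0 \<le> a T u \<and> a T u \<le> M)
        \<and> s * c \<le> s * (\<Sum>u\<in>U. a T u * of_bool (\<tau> u \<in> T))
        \<and> (s + s\<^sup>2) * (\<Sum>u\<in>U. a T u) \<le> (s + s\<^sup>2) * L"
  shows "measure_pmf.prob (random_subset A p) E \<le> exp (p * (s + s\<^sup>2) * (L / M) - s * (c / M))"
proof -
  define B where "B = \<tau> ` U"
  let ?e = "exp (p * (s + s\<^sup>2) * (L / M) - s * (c / M))"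
  have B: "finite B" "B \<subseteq> A" using U by (auto simp: B_def)
  have eq: "random_subset A p = bind_pmf (random_subset (A - B) p)
      (\<lambda>S. map_pmf (\<lambda>S'. S \<union> S') (random_subset B p))"
  proof -
    have "(A - B) \<union> B = A" using B by auto
    moreover have "(A - B) \<inter> B = {}" by auto
    ultimately show ?thesis using random_subset_union[of "A - B" B p] A B by simp
  qed
  \<comment> \<open>Intersecting with \<open>A - B\<close> changes nothing on the support, but makes
    the bound below valid for every \<open>S\<close>, as \<open>prob_bind_pmf_le\<close>
    demands.\<close>
  have eq': "random_subset A p = bind_pmf (random_subset (A - B) p)
      (\<lambda>S. map_pmf (\<lambda>S'. (S \<inter> (A - B)) \<union> S') (random_subset B p))"
    unfolding eq
    by (intro bind_pmf_cong refl map_pmf_cong) (auto simp: random_subset_def)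
  have "measure_pmf.prob (map_pmf (\<lambda>S'. (S \<inter> (A - B)) \<union> S') (random_subset B p)) E \<le> ?e" for S
  proof -
    define R where "R = S \<inter> (A - B)"
    define w where "w t = a R (the_inv_into U \<tau> t) / M" for t
    have w: "w (\<tau> u) = a R u / M" if "u \<in> U" for u
      using U that by (simp add: w_def the_inv_into_f_f)
    show ?thesis
    proof (cases "(\<forall>u\<in>U. 0 \<le> a R u \<and> a R u \<le> M) \<and> (s + s\<^sup>2) * (\<Sum>u\<in>U. a R u) \<le> (s + s\<^sup>2) * L")
      case True
      have sub: "R \<union> {t \<in> B. f t} \<in> E \<Longrightarrow> s * (c / M) \<le> s * (\<Sum>t\<in>B. w t * of_bool (f t))" for f
      proof -
        let ?T = "R \<union> {t \<in> B. f t}"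
        assume "?T \<in> E"
        moreover have "?T \<subseteq> A" using B by (auto simp: R_def)
        moreover have "?T - \<tau> ` U = R" by (auto simp: R_def B_def)
        ultimately have "s * c \<le> s * (\<Sum>u\<in>U. a R u * of_bool (\<tau> u \<in> ?T))"
          using imp[of ?T] indep[of ?T] by (auto cong: sum.cong)
        moreover have "(\<Sum>u\<in>U. a R u * of_bool (\<tau> u \<in> ?T)) = M * (\<Sum>t\<in>B. w t * of_bool (f t))"
          unfolding B_def using U M
          by (subst sum.reindex) (auto simp: sum_distrib_left w R_def B_def intro!: sum.cong)
        ultimately show ?thesis using M by (simp add: field_simps)
      qed
      have "measure_pmf.prob (map_pmf (\<lambda>S'. R \<union> S') (random_subset B p)) E
          = measure_pmf.prob (Pi_pmf B False (\<lambda>_. bernoulli_pmf p)) {f. R \<union> {t \<in> B. f t} \<in> E}"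
        by (simp add: random_subset_def vimage_def)
      also have "\<dots> \<le> measure_pmf.prob (Pi_pmf B False (\<lambda>_. bernoulli_pmf p))
          {f. s * (c / M) \<le> s * (\<Sum>t\<in>B. w t * of_bool (f t))}"
        using sub by (intro measure_pmf.finite_measure_mono) auto
      also have "\<dots> \<le> exp (p * (s + s\<^sup>2) * (\<Sum>t\<in>B. w t) - s * (c / M))"
        using True M by (intro weighted_bernoulli_tail B p s) (auto simp: B_def w)
      also have "\<dots> \<le> ?e"
      proof -
        have "(\<Sum>t\<in>B. w t) = (\<Sum>u\<in>U. a R u) / M"
          unfolding B_def using U by (subst sum.reindex) (auto simp: w sum_divide_distrib intro!: sum.cong)
        moreover have "p * (((s + s\<^sup>2) * (\<Sum>u\<in>U. a R u)) / M) \<le> p * (((s + s\<^sup>2) * L) / M)"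
          using True M p by (intro mult_left_mono[of _ _ p] divide_right_mono[of _ _ M]) auto
        ultimately show ?thesis by (simp add: mult.assoc)
      qed
      finally show ?thesis by (simp add: R_def)
    next
      \<comment> \<open>By \<open>indep\<close> the weights are determined by \<open>R\<close>. If
        they violate the requirements in \<open>imp\<close>, no completion of \<open>R\<close> lies
        in \<open>E\<close>.\<close>
      case False
      have "R \<union> S' \<notin> E" if "S' \<subseteq> B" for S'
      proof
        assume E: "R \<union> S' \<in> E"
        have 1: "R \<union> S' \<subseteq> A" using that B by (auto simp: R_def)
        have 2: "R \<union> S' - \<tau> ` U = R" using that by (auto simp: R_def B_def)
        show False using imp[OF 1 E] indep[OF 1] False 2 by (auto cong: sum.cong)
      qed
      then have "measure_pmf.prob (map_pmf (\<lambda>S'. R \<union> S') (random_subset B p)) E = 0"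
        by (subst measure_pmf_zero_iff) (auto simp: random_subset_def)
      then show ?thesis by (simp add: R_def)
    qed
  qed
  then show ?thesis unfolding eq' by (rule prob_bind_pmf_le)
qed

text \<open>Up to the factor \<open>p * L / M\<close> the exponent is \<open>s^2 - s * d\<close>,
  minimal at \<open>s = d / 2\<close> with value \<open>- d^2 / 4\<close>.\<close>

lemma random_subset_upper_tail:
  fixes a :: "'a set \<Rightarrow> 'b \<Rightarrow> real"
  assumes "finite A" "0 \<le> p" "p \<le> 1" "finite U" "inj_on \<tau> U" "\<tau> ` U \<subseteq> A"
    and "\<And>T u. T \<subseteq> A \<Longrightarrow> u \<in> U \<Longrightarrow> a (T - \<tau> ` U) u = a T u"
    and "0 < M" and d: "0 < d" "d \<le> 1"
  shows "measure_pmf.prob (random_subset A p)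
     {T. (\<forall>u\<in>U. 0 \<le> a T u \<and> a T u \<le> M) \<and> (\<Sum>u\<in>U. a T u) \<le> L \<and>
         (1 + d) * p * L \<le> (\<Sum>u\<in>U. a T u * of_bool (\<tau> u \<in> T))} \<le> exp (- (d\<^sup>2 * p * L / (4 * M)))"
    (is "measure_pmf.prob _ ?E \<le> _")
proof -
  have "measure_pmf.prob (random_subset A p) ?E
      \<le> exp (p * (d / 2 + (d / 2)\<^sup>2) * (L / M) - d / 2 * ((1 + d) * p * L / M))"
    by (rule random_subset_weighted_tail[where a=a and U=U and \<tau>=\<tau>])
       (use assms in \<open>auto intro!: mult_left_mono\<close>)
  also have "p * (d / 2 + (d / 2)\<^sup>2) * (L / M) - d / 2 * ((1 + d) * p * L / M) = - (d\<^sup>2 * p * L / (4 * M))"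
    using assms(8) by (simp add: field_simps power2_eq_square)
  finally show ?thesis .
qed

text \<open>The mirror image with \<open>s = - d / 2\<close>. Now \<open>s + s^2 \<le> 0\<close>, so
  a lower bound on the total weight bounds the exponent from above.\<close>

lemma random_subset_lower_tail:
  fixes a :: "'a set \<Rightarrow> 'b \<Rightarrow> real"
  assumes "finite A" "0 \<le> p" "p \<le> 1" "finite U" "inj_on \<tau> U" "\<tau> ` U \<subseteq> A"
    and "\<And>T u. T \<subseteq> A \<Longrightarrow> u \<in> U \<Longrightarrow> a (T - \<tau> ` U) u = a T u"
    and "0 < M" and d: "0 < d" "d \<le> 1"
  shows "measure_pmf.prob (random_subset A p)
     {T. (\<forall>u\<in>U. 0 \<le> a T u \<and> a T u \<le> M) \<and> L \<le> (\<Sum>u\<in>U. a T u) \<and>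
         (\<Sum>u\<in>U. a T u * of_bool (\<tau> u \<in> T)) \<le> (1 - d) * p * L} \<le> exp (- (d\<^sup>2 * p * L / (4 * M)))"
    (is "measure_pmf.prob _ ?E \<le> _")
proof -
  have neg: "- (d / 2) + (- (d / 2))\<^sup>2 \<le> 0"
    using d mult_left_le[of d d] by (simp add: power2_eq_square)
  have "measure_pmf.prob (random_subset A p) ?E
      \<le> exp (p * (- (d / 2) + (- (d / 2))\<^sup>2) * (L / M) - (- (d / 2)) * ((1 - d) * p * L / M))"
    by (rule random_subset_weighted_tail[where a=a and U=U and \<tau>=\<tau>])
       (use assms neg in \<open>auto intro!: mult_left_mono mult_left_mono_neg\<close>)
  also have "p * (- (d / 2) + (- (d / 2))\<^sup>2) * (L / M) - (- (d / 2)) * ((1 - d) * p * L / M) = - (d\<^sup>2 * p * L / (4 * M))"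
    using assms(8) by (simp add: field_simps power2_eq_square)
  finally show ?thesis .
qed

section \<open>Filling loops along paths\<close>

definition tri :: "'v set set \<Rightarrow> 'v \<Rightarrow> 'v \<Rightarrow> 'v \<Rightarrow> real" where
  "tri T x y z = of_bool ({x, y, z} \<in> T)"

lemma tri_nonneg [simp]: "0 \<le> tri T x y z"
  and tri_le_1 [simp]: "tri T x y z \<le> 1"
  by (simp_all add: tri_def)

lemma tri_rotate: "tri T x y z = tri T y z x"
  by (simp add: tri_def insert_commute)

lemma tri_swap: "tri T x y z = tri T y x z"
  by (simp add: tri_def insert_commute)

lemma tri_distinct:
  assumes "\<And>t. t \<in> T \<Longrightarrow> card t = 3" "tri T x y z \<noteq> 0"
  shows "x \<noteq> y" "y \<noteq> z" "x \<noteq> z"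
proof -
  have "card {x, y, z} = 3" using assms by (auto simp: tri_def split: if_splits)
  then show "x \<noteq> y" "y \<noteq> z" "x \<noteq> z" by (auto simp: card_insert_if split: if_splits)
qed

text \<open>The graph on the vertices in which \<open>u\<close> and \<open>v\<close> are adjacent iff both \<open>x u v\<close> and \<open>y u v\<close>
  are triangles: crossing such an edge replaces the loop \<open>x y u\<close> by \<open>x y v\<close> at the cost of two
  triangles. The sum below runs over its paths \<open>u = u\<^sub>0, \<dots>, u\<^sub>j\<close> without repetition that avoid
  \<open>A\<close>, each counted with the value of \<open>g\<close> at its endpoint.\<close>

primrec path_sum :: "'v set \<Rightarrow> 'v set set \<Rightarrow> 'v \<Rightarrow> 'v \<Rightarrow> ('v \<Rightarrow> real) \<Rightarrow> nat \<Rightarrow> 'v set \<Rightarrow> 'v \<Rightarrow> real" where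
  "path_sum V T x y g 0 A u = g u"
| "path_sum V T x y g (Suc j) A u =
     (\<Sum>v\<in>V - insert u A. tri T x u v * tri T y u v * path_sum V T x y g j (insert u A) v)"

text \<open>An endpoint \<open>w\<close> with \<open>{x, y, w} \<in> T\<close> completes a path to a
  filling of the loop \<open>x y u\<close> by \<open>2 * j + 1\<close> triangles: two per edge and
  one at the end.\<close>

abbreviation closed_path_sum :: "'v set \<Rightarrow> 'v set set \<Rightarrow> 'v \<Rightarrow> 'v \<Rightarrow> nat \<Rightarrow> 'v set \<Rightarrow> 'v \<Rightarrow> real" where
  "closed_path_sum V T x y \<equiv> path_sum V T x y (tri T x y)"

lemma path_sum_nonneg:
  assumes "\<And>v. 0 \<le> g v"
  shows "0 \<le> path_sum V T x y g j A u"
  using assms by (induction j arbitrary: A u) (auto intro!: sum_nonneg)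

lemma path_sum_antimono:
  assumes "finite V" "\<And>v. 0 \<le> g v" "A \<subseteq> A'"
  shows "path_sum V T x y g j A' u \<le> path_sum V T x y g j A u"
  using assms(3)
proof (induction j arbitrary: A A' u)
  case (Suc j)
  have "path_sum V T x y g (Suc j) A' u
      \<le> (\<Sum>v\<in>V - insert u A'. tri T x u v * tri T y u v * path_sum V T x y g j (insert u A) v)"
    using Suc.prems by (auto intro!: sum_mono mult_left_mono Suc.IH)
  also have "\<dots> \<le> path_sum V T x y g (Suc j) A u"
    using Suc assms(1,2) by (auto intro!: sum_mono2 mult_nonneg_nonneg path_sum_nonneg)
  finally show ?case .
qed simp

lemma path_sum_swap: "path_sum V T x y g j A u = path_sum V T y x g j A u"
  by (induction j arbitrary: A u) (auto intro!: sum.cong)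

lemma closed_path_sum_swap: "closed_path_sum V T x y j A u = closed_path_sum V T y x j A u"
proof -
  have "tri T x y = tri T y x" by (auto simp: tri_swap)
  then show ?thesis by (simp add: path_sum_swap)
qed

lemma closed_path_sum_eq_0:
  assumes "\<And>t. t \<in> T \<Longrightarrow> card t = 3"
  shows "closed_path_sum V T x x j A u = 0"
proof -
  have "tri T x x v = 0" for v using tri_distinct(1)[OF assms] by blast
  then have "tri T x x = (\<lambda>_. 0)" by auto
  moreover have "path_sum V T x x (\<lambda>_. 0) j A u = 0"
    by (induction j arbitrary: A u) auto
  ultimately show ?thesis by simp
qed

text \<open>Only triangles formed by \<open>x\<close> or \<open>y\<close> and two visited vertices
  matter, and after the start all visited vertices lie outside \<open>A\<close>. This yields the
  independence hypothesis of the tail bounds.\<close>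

lemma path_sum_cong:
  assumes "\<And>a b. a \<in> V - A \<union> {u} \<Longrightarrow> b \<in> V - insert u A \<Longrightarrow>
      tri T x a b = tri T' x a b \<and> tri T y a b = tri T' y a b"
    and "\<And>a. a \<in> V - A \<union> {u} \<Longrightarrow> g a = g' a"
  shows "path_sum V T x y g j A u = path_sum V T' x y g' j A u"
  using assms
proof (induction j arbitrary: A u)
  case (Suc j)
  have "path_sum V T x y g j (insert u A) v = path_sum V T' x y g' j (insert u A) v"
    if "v \<in> V - insert u A" for v
    using that Suc.prems by (intro Suc.IH) auto
  then show ?case using Suc.prems by (auto intro!: sum.cong)
qed simp

text \<open>Sorting paths by endpoint separates the counts between two fixed vertices from the
  closing weight \<open>g\<close>, so that the two can be exposed one after the other.\<close>

lemma path_sum_expand: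
  assumes "finite V" "u \<in> V - B" "B \<subseteq> A"
  shows "path_sum V T x y g j A u =
    (\<Sum>v\<in>V - B. path_sum V T x y (\<lambda>w. of_bool (w = v)) j A u * g v)"
  using assms(2,3)
proof (induction j arbitrary: A u)
  case 0
  then show ?case using assms(1) by (simp add: of_bool_def if_distrib[where f="\<lambda>a. a * _"] cong: if_cong)
next
  case (Suc j)
  have "path_sum V T x y g (Suc j) A u = (\<Sum>w\<in>V - insert u A. tri T x u w * tri T y u w *
      (\<Sum>v\<in>V - B. path_sum V T x y (\<lambda>w. of_bool (w = v)) j (insert u A) w * g v))"
    using Suc.prems by (simp, intro sum.cong refl, subst Suc.IH) auto
  also have "\<dots> = (\<Sum>v\<in>V - B. path_sum V T x y (\<lambda>w. of_bool (w = v)) (Suc j) A u * g v)"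
    by (simp add: sum_distrib_left sum_distrib_right mult.assoc) (rule sum.swap)
  finally show ?case .
qed

lemma path_sum_le:
  assumes "finite V" "0 \<le> D" "\<And>v. 0 \<le> g v" "\<And>v. g v \<le> 1"
    and deg: "\<And>v. v \<in> V - B \<Longrightarrow> (\<Sum>w\<in>V. tri T x v w * tri T y v w) \<le> D"
    and u: "u \<in> V - B" "B \<subseteq> A"
  shows "path_sum V T x y g j A u \<le> D ^ j"
  using u
proof (induction j arbitrary: A u)
  case (Suc j)
  have "path_sum V T x y g (Suc j) A u \<le> (\<Sum>v\<in>V - insert u A. tri T x u v * tri T y u v * D ^ j)"
    using Suc.prems by (auto intro!: sum_mono mult_left_mono Suc.IH)
  also have "\<dots> \<le> (\<Sum>v\<in>V. tri T x u v * tri T y u v * D ^ j)"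
    using assms(1,2) by (intro sum_mono2) auto
  also have "\<dots> = (\<Sum>v\<in>V. tri T x u v * tri T y u v) * D ^ j"
    by (simp add: sum_distrib_right)
  also have "\<dots> \<le> D * D ^ j"
    using deg Suc.prems assms(2) by (intro mult_right_mono) auto
  finally show ?case by simp
qed (use assms in auto)

text \<open>Of at least \<open>d + m\<close> neighbours at most \<open>m\<close> are forbidden. The
  bound \<open>card A + j \<le> m\<close> survives a step, as \<open>A\<close> gains at most one
  vertex while \<open>j\<close> drops by one.\<close>

lemma path_sum_ge:
  assumes "finite V" "0 \<le> d"
    and deg: "\<And>v. v \<in> V - B \<Longrightarrow> d + real m \<le> (\<Sum>w\<in>V. tri T x v w * tri T y v w)"
    and u: "u \<in> V - B" "B \<subseteq> A" "finite A" "card A + j \<le> m"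
  shows "d ^ j \<le> path_sum V T x y (\<lambda>_. 1) j A u"
  using u
proof (induction j arbitrary: A u)
  case (Suc j)
  have A: "finite (insert u A)" "card (insert u A) + j \<le> m"
    using Suc.prems by (auto simp: card_insert_if)
  have "d + real m \<le> (\<Sum>v\<in>V. tri T x u v * tri T y u v)"
    using deg Suc.prems by auto
  also have "\<dots> \<le> (\<Sum>v\<in>(V - insert u A) \<union> insert u A. tri T x u v * tri T y u v)"
    using assms(1) A by (intro sum_mono2) auto
  also have "\<dots> = (\<Sum>v\<in>V - insert u A. tri T x u v * tri T y u v) + (\<Sum>v\<in>insert u A. tri T x u v * tri T y u v)"
    using assms(1) A by (intro sum.union_disjoint) auto
  also have "(\<Sum>v\<in>insert u A. tri T x u v * tri T y u v) \<le> (\<Sum>v\<in>insert u A. 1)"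
    by (intro sum_mono mult_le_one) auto
  also have "(\<Sum>v\<in>insert u A. 1) \<le> real m" using A by simp
  finally have d: "d \<le> (\<Sum>v\<in>V - insert u A. tri T x u v * tri T y u v)" by simp
  then have "d * d ^ j \<le> (\<Sum>v\<in>V - insert u A. tri T x u v * tri T y u v) * d ^ j"
    using assms(2) by (intro mult_right_mono) auto
  also have "\<dots> \<le> path_sum V T x y (\<lambda>_. 1) (Suc j) A u"
    using Suc.prems A by (auto simp: sum_distrib_right intro!: sum_mono mult_left_mono Suc.IH)
  finally show ?case by simp
qed simp

text \<open>Counts paths backwards from their common endpoint \<open>v\<close>, which works because
  adjacency is symmetric.\<close>

lemma sum_path_sum_endpoint_le:
  assumes "finite V" "0 \<le> D" "B \<subseteq> A" "v \<in> V"
    and deg: "\<And>v. v \<in> V - B \<Longrightarrow> (\<Sum>w\<in>V. tri T x v w * tri T y v w) \<le> D"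
  shows "(\<Sum>u\<in>V - A. path_sum V T x y (\<lambda>w. of_bool (w = v)) j A u) \<le> D ^ j"
  using assms(3)
proof (induction j arbitrary: A)
  case 0
  have "(\<Sum>u\<in>V - A. of_bool (u = v)) \<le> (1::real)"
    using assms(1,4) by (simp add: of_bool_def cong: if_cong)
  then show ?case by simp
next
  case (Suc j)
  let ?P = "\<lambda>A. path_sum V T x y (\<lambda>w. of_bool (w = v)) j A"
  have P: "0 \<le> ?P A w" for A w by (rule path_sum_nonneg) simp
  \<comment> \<open>Lifting the ban on \<open>u\<close> for the rest of the path decouples that
    count from \<open>u\<close>; the sum over \<open>u\<close> is then a degree of
    \<open>w\<close>.\<close>
  have "(\<Sum>u\<in>V - A. path_sum V T x y (\<lambda>w. of_bool (w = v)) (Suc j) A u)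
      \<le> (\<Sum>u\<in>V - A. \<Sum>w\<in>V - A. tri T x u w * tri T y u w * ?P A w)"
    unfolding path_sum.simps
  proof (intro sum_mono)
    fix u assume "u \<in> V - A"
    have "(\<Sum>w\<in>V - insert u A. tri T x u w * tri T y u w * ?P (insert u A) w)
       \<le> (\<Sum>w\<in>V - insert u A. tri T x u w * tri T y u w * ?P A w)"
      using assms(1) by (intro sum_mono mult_left_mono path_sum_antimono) auto
    also have "\<dots> \<le> (\<Sum>w\<in>V - A. tri T x u w * tri T y u w * ?P A w)"
      using assms(1) P by (intro sum_mono2) auto
    finally show "(\<Sum>w\<in>V - insert u A. tri T x u w * tri T y u w * ?P (insert u A) w)
       \<le> (\<Sum>w\<in>V - A. tri T x u w * tri T y u w * ?P A w)" .
  qed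
  also have "\<dots> = (\<Sum>w\<in>V - A. (\<Sum>u\<in>V - A. tri T x u w * tri T y u w) * ?P A w)"
    by (subst sum.swap) (simp add: sum_distrib_right)
  also have "\<dots> \<le> (\<Sum>w\<in>V - A. D * ?P A w)"
  proof (intro sum_mono mult_right_mono P)
    fix w assume w: "w \<in> V - A"
    have "(\<Sum>u\<in>V - A. tri T x u w * tri T y u w) \<le> (\<Sum>u\<in>V. tri T x u w * tri T y u w)"
      using assms(1) by (intro sum_mono2) auto
    also have "\<dots> = (\<Sum>u\<in>V. tri T x w u * tri T y w u)"
      by (simp add: tri_def insert_commute)
    also have "\<dots> \<le> D" using deg w Suc.prems by auto
    finally show "(\<Sum>u\<in>V - A. tri T x u w * tri T y u w) \<le> D" .
  qed
  also have "\<dots> \<le> D * D ^ j"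
    using Suc assms(2) by (simp flip: sum_distrib_left) (intro mult_left_mono, auto)
  finally show ?case by simp
qed

text \<open>\<open>F\<close> is the defect of a triangle. Filling the loop \<open>x y z\<close> along a random path from \<open>z\<close> to a
  vertex \<open>w\<close> with \<open>x y w \<in> T\<close> uses \<open>2 * k + 1\<close> triangles of \<open>T\<close>; \<open>load\<close> says that none of
  them is used too often in total.\<close>

lemma sum_defect_le:
  fixes F :: "'v \<Rightarrow> 'v \<Rightarrow> 'v \<Rightarrow> real"
  assumes V: "finite V" and T: "\<And>t. t \<in> T \<Longrightarrow> card t = 3"
    and F0: "\<And>x y z. 0 \<le> F x y z" and Fd: "\<And>x y z. x = y \<or> y = z \<or> x = z \<Longrightarrow> F x y z = 0"
    and tetra: "\<And>x y z u. {x, y, z, u} \<subseteq> V \<Longrightarrow> F x y z \<le> F x y u + F x z u + F y z u"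
    and load: "\<And>i x z u. i < k \<Longrightarrow> {x, z, u} \<subseteq> V \<Longrightarrow> distinct [x, z, u] \<Longrightarrow>
      (\<Sum>y\<in>V. tri T y z u * closed_path_sum V T x y i {x, y, z} u) \<le> D ^ Suc i"
    and D: "0 \<le> D"
    and q: "\<And>x y z. {x, y, z} \<subseteq> V \<Longrightarrow> distinct [x, y, z] \<Longrightarrow> q \<le> closed_path_sum V T x y k {x, y} z"
  shows "q * (\<Sum>x\<in>V. \<Sum>y\<in>V. \<Sum>z\<in>V. F x y z)
    \<le> real (2 * k + 1) * D ^ k * (\<Sum>x\<in>V. \<Sum>y\<in>V. \<Sum>z\<in>V. tri T x y z * F x y z)"
    (is "q * ?S \<le> _ * ?\<Phi>")
proof -
  let ?Q = "closed_path_sum V T"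
  have Q0: "0 \<le> ?Q x y i A z" for x y i A z by (rule path_sum_nonneg) simp
  \<comment> \<open>Induction on the path length. Of the three faces, \<open>x y u\<close> continues
    along the path at the cost of a factor \<open>D\<close>, and each of the other two adds
    \<open>D ^ Suc i * ?\<Phi>\<close>: hence \<open>(2 * i + 1) + 2\<close> in the next
    coefficient.\<close>
  have main: "(\<Sum>x\<in>V. \<Sum>y\<in>V. \<Sum>z\<in>V. F x y z * ?Q x y i {x, y} z) \<le> real (2 * i + 1) * D ^ i * ?\<Phi>"
    if "i \<le> k" for i
    using that
  proof (induction i)
    case 0
    then show ?case by (simp add: mult.commute)
  next
    case (Suc i)
    let ?a = "\<lambda>x y z u. tri T x z u * tri T y z u"
    \<comment> \<open>With paths of length 0, \<open>load\<close> is a bound on the degrees of the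
      graph.\<close>
    have deg: "(\<Sum>z\<in>V. ?a x y z u) \<le> D" if "{x, y, u} \<subseteq> V" "distinct [x, y, u]" for x y u
    proof -
      have "(\<Sum>z\<in>V. ?a x y z u) = (\<Sum>z\<in>V. tri T z y u * tri T x z u)"
        by (intro sum.cong refl) (simp add: tri_def insert_commute)
      then show ?thesis using load[of 0 x y u] that Suc.prems by simp
    qed
    \<comment> \<open>With \<open>x z u\<close> fixed, summing over \<open>y\<close> first leaves
      exactly the load of that triangle.\<close>
    have cross: "(\<Sum>x\<in>V. \<Sum>y\<in>V. \<Sum>z\<in>V. \<Sum>u\<in>V. ?a x y z u * F x z u * ?Q x y i {x, y, z} u) \<le> D ^ Suc i * ?\<Phi>"
    proof -
      have "(\<Sum>x\<in>V. \<Sum>y\<in>V. \<Sum>z\<in>V. \<Sum>u\<in>V. ?a x y z u * F x z u * ?Q x y i {x, y, z} u)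
          = (\<Sum>x\<in>V. \<Sum>z\<in>V. \<Sum>y\<in>V. \<Sum>u\<in>V. ?a x y z u * F x z u * ?Q x y i {x, y, z} u)"
        by (intro sum.cong refl sum.swap)
      also have "\<dots> = (\<Sum>x\<in>V. \<Sum>z\<in>V. \<Sum>u\<in>V. \<Sum>y\<in>V. ?a x y z u * F x z u * ?Q x y i {x, y, z} u)"
        by (intro sum.cong refl sum.swap)
      also have "\<dots> = (\<Sum>x\<in>V. \<Sum>z\<in>V. \<Sum>u\<in>V. tri T x z u * F x z u *
          (\<Sum>y\<in>V. tri T y z u * ?Q x y i {x, y, z} u))"
        by (intro sum.cong refl) (simp add: sum_distrib_left mult_ac)
      also have "\<dots> \<le> (\<Sum>x\<in>V. \<Sum>z\<in>V. \<Sum>u\<in>V. tri T x z u * F x z u * D ^ Suc i)"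
      proof (intro sum_mono)
        fix x z u assume xzu: "x \<in> V" "z \<in> V" "u \<in> V"
        show "tri T x z u * F x z u * (\<Sum>y\<in>V. tri T y z u * ?Q x y i {x, y, z} u)
            \<le> tri T x z u * F x z u * D ^ Suc i"
        proof (cases "distinct [x, z, u]")
          case True
          then show ?thesis
            using load[of i x z u] Suc.prems F0 xzu by (intro mult_left_mono) auto
        next
          case False
          then have "F x z u = 0" by (intro Fd) auto
          then show ?thesis by simp
        qed
      qed
      also have "\<dots> = D ^ Suc i * ?\<Phi>"
        by (simp add: sum_distrib_left sum_distrib_right mult_ac)
      finally show ?thesis .
    qed
    have "(\<Sum>x\<in>V. \<Sum>y\<in>V. \<Sum>z\<in>V. \<Sum>u\<in>V. ?a x y z u * F y z u * ?Q x y i {x, y, z} u)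
        = (\<Sum>y\<in>V. \<Sum>x\<in>V. \<Sum>z\<in>V. \<Sum>u\<in>V. ?a x y z u * F y z u * ?Q x y i {x, y, z} u)"
      by (rule sum.swap)
    also have "\<dots> = (\<Sum>x\<in>V. \<Sum>y\<in>V. \<Sum>z\<in>V. \<Sum>u\<in>V. ?a x y z u * F x z u * ?Q x y i {x, y, z} u)"
      by (intro sum.cong refl) (simp add: closed_path_sum_swap[of V T _ _ i] insert_commute mult_ac)
    finally have cross': "(\<Sum>x\<in>V. \<Sum>y\<in>V. \<Sum>z\<in>V. \<Sum>u\<in>V. ?a x y z u * F y z u * ?Q x y i {x, y, z} u)
        \<le> D ^ Suc i * ?\<Phi>" using cross by simp
    have "(\<Sum>x\<in>V. \<Sum>y\<in>V. \<Sum>z\<in>V. F x y z * ?Q x y (Suc i) {x, y} z)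
        \<le> (\<Sum>x\<in>V. \<Sum>y\<in>V. \<Sum>z\<in>V. \<Sum>u\<in>V. ?a x y z u * F x y u * ?Q x y i {x, y} u
            + ?a x y z u * F x z u * ?Q x y i {x, y, z} u + ?a x y z u * F y z u * ?Q x y i {x, y, z} u)"
    proof (intro sum_mono)
      fix x y z assume xyz: "x \<in> V" "y \<in> V" "z \<in> V"
      have ins: "insert z {x, y} = {x, y, z}" by auto
      have "F x y z * ?Q x y (Suc i) {x, y} z
          = (\<Sum>u\<in>V - {x, y, z}. ?a x y z u * F x y z * ?Q x y i {x, y, z} u)"
        by (simp add: ins sum_distrib_left mult_ac)
      also have "\<dots> \<le> (\<Sum>u\<in>V. ?a x y z u * F x y z * ?Q x y i {x, y, z} u)"
        using V F0 Q0 by (intro sum_mono2) auto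
      also have "\<dots> \<le> (\<Sum>u\<in>V. ?a x y z u * (F x y u * ?Q x y i {x, y} u
            + (F x z u + F y z u) * ?Q x y i {x, y, z} u))"
      proof (intro sum_mono)
        fix u assume u: "u \<in> V"
        have "F x y z * ?Q x y i {x, y, z} u \<le> (F x y u + F x z u + F y z u) * ?Q x y i {x, y, z} u"
          using tetra xyz u Q0 by (intro mult_right_mono) auto
        also have "\<dots> = F x y u * ?Q x y i {x, y, z} u + (F x z u + F y z u) * ?Q x y i {x, y, z} u"
          by (simp add: algebra_simps)
        \<comment> \<open>Permitting \<open>z\<close> again turns the weight into that of the
          induction hypothesis.\<close>
        also have "F x y u * ?Q x y i {x, y, z} u \<le> F x y u * ?Q x y i {x, y} u"
          using V F0 by (intro mult_left_mono path_sum_antimono) auto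
        finally have "?a x y z u * (F x y z * ?Q x y i {x, y, z} u) \<le> ?a x y z u * (F x y u * ?Q x y i {x, y} u
            + (F x z u + F y z u) * ?Q x y i {x, y, z} u)"
          by (intro mult_left_mono) auto
        then show "?a x y z u * F x y z * ?Q x y i {x, y, z} u \<le> ?a x y z u * (F x y u * ?Q x y i {x, y} u
            + (F x z u + F y z u) * ?Q x y i {x, y, z} u)" by (simp only: mult.assoc)
      qed
      finally show "F x y z * ?Q x y (Suc i) {x, y} z \<le> (\<Sum>u\<in>V. ?a x y z u * F x y u * ?Q x y i {x, y} u
            + ?a x y z u * F x z u * ?Q x y i {x, y, z} u + ?a x y z u * F y z u * ?Q x y i {x, y, z} u)"
        by (simp add: algebra_simps)
    qed
    also have "\<dots> = (\<Sum>x\<in>V. \<Sum>y\<in>V. \<Sum>z\<in>V. \<Sum>u\<in>V. ?a x y z u * F x y u * ?Q x y i {x, y} u)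
       + (\<Sum>x\<in>V. \<Sum>y\<in>V. \<Sum>z\<in>V. \<Sum>u\<in>V. ?a x y z u * F x z u * ?Q x y i {x, y, z} u)
       + (\<Sum>x\<in>V. \<Sum>y\<in>V. \<Sum>z\<in>V. \<Sum>u\<in>V. ?a x y z u * F y z u * ?Q x y i {x, y, z} u)"
      by (simp only: sum.distrib)
    also have "(\<Sum>x\<in>V. \<Sum>y\<in>V. \<Sum>z\<in>V. \<Sum>u\<in>V. ?a x y z u * F x y u * ?Q x y i {x, y} u)
       \<le> (\<Sum>x\<in>V. \<Sum>y\<in>V. \<Sum>u\<in>V. D * (F x y u * ?Q x y i {x, y} u))"
    proof (rule sum_mono, rule sum_mono)
      fix x y assume xy: "x \<in> V" "y \<in> V"
      have "(\<Sum>z\<in>V. \<Sum>u\<in>V. ?a x y z u * F x y u * ?Q x y i {x, y} u)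
         = (\<Sum>u\<in>V. (\<Sum>z\<in>V. ?a x y z u) * (F x y u * ?Q x y i {x, y} u))"
        by (subst sum.swap) (simp add: sum_distrib_right mult.assoc)
      also have "\<dots> \<le> (\<Sum>u\<in>V. D * (F x y u * ?Q x y i {x, y} u))"
      proof (intro sum_mono)
        fix u assume u: "u \<in> V"
        show "(\<Sum>z\<in>V. ?a x y z u) * (F x y u * ?Q x y i {x, y} u) \<le> D * (F x y u * ?Q x y i {x, y} u)"
        proof (cases "distinct [x, y, u]")
          case True
          then show ?thesis
            using xy u F0 Q0 by (intro mult_right_mono deg) auto
        next
          case False
          then have "F x y u = 0" by (intro Fd) auto
          then show ?thesis by simp
        qed
      qed
      finally show "(\<Sum>z\<in>V. \<Sum>u\<in>V. ?a x y z u * F x y u * ?Q x y i {x, y} u)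
         \<le> (\<Sum>u\<in>V. D * (F x y u * ?Q x y i {x, y} u))" .
    qed
    also have "\<dots> = D * (\<Sum>x\<in>V. \<Sum>y\<in>V. \<Sum>u\<in>V. F x y u * ?Q x y i {x, y} u)"
      by (simp add: sum_distrib_left)
    also have "\<dots> \<le> D * (real (2 * i + 1) * D ^ i * ?\<Phi>)"
      using Suc D by (intro mult_left_mono) auto
    finally show ?case using cross cross' by (simp add: algebra_simps)
  qed
  have "q * ?S = (\<Sum>x\<in>V. \<Sum>y\<in>V. \<Sum>z\<in>V. F x y z * q)"
    by (simp add: sum_distrib_left mult.commute)
  also have "\<dots> \<le> (\<Sum>x\<in>V. \<Sum>y\<in>V. \<Sum>z\<in>V. F x y z * ?Q x y k {x, y} z)"
  proof (intro sum_mono)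
    fix x y z assume xyz: "x \<in> V" "y \<in> V" "z \<in> V"
    show "F x y z * q \<le> F x y z * ?Q x y k {x, y} z"
    proof (cases "distinct [x, y, z]")
      case True
      then show ?thesis
        using xyz F0 by (intro mult_left_mono q) auto
    next
      case False
      then have "F x y z = 0" by (intro Fd) auto
      then show ?thesis by simp
    qed
  qed
  also have "\<dots> \<le> real (2 * k + 1) * D ^ k * ?\<Phi>" by (rule main) simp
  finally show ?thesis .
qed

section \<open>Cochains and their cones\<close>

lemma d_h_same: "0 < N \<Longrightarrow> d_h (N, \<sigma>) (N, \<tau>) = real (card {i \<in> {1..N}. \<sigma> i \<noteq> \<tau> i}) / real N"
proof -
  assume N: "0 < N"
  have "{1..N} = {i \<in> {1..N}. \<sigma> i = \<tau> i} \<union> {i \<in> {1..N}. \<sigma> i \<noteq> \<tau> i}" by auto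
  then have "card {1..N} = card {i \<in> {1..N}. \<sigma> i = \<tau> i} + card {i \<in> {1..N}. \<sigma> i \<noteq> \<tau> i}"
    by (subst (1) \<open>{1..N} = _\<close>, subst card_Un_disjoint) auto
  then have "real N = real (card {i \<in> {1..N}. \<sigma> i = \<tau> i}) + real (card {i \<in> {1..N}. \<sigma> i \<noteq> \<tau> i})"
    by simp
  then show ?thesis using N by (simp add: d_h_def field_simps)
qed

lemma d_h_nonneg: "0 \<le> d_h a b"
proof -
  obtain n \<sigma> N \<tau> where [simp]: "a = (n, \<sigma>)" "b = (N, \<tau>)" by fastforce
  have "card {i \<in> {1..min n N}. \<sigma> i = \<tau> i} \<le> card {1..min n N}" by (intro card_mono) auto
  also have "\<dots> \<le> max n N" by simp
  finally have "real (card {i \<in> {1..min n N}. \<sigma> i = \<tau> i}) / real (max n N) \<le> 1"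
    by (intro divide_le_eq_1[THEN iffD2]) linarith
  then show ?thesis by (simp add: d_h_def)
qed

lemma d_h_triangle:
  assumes "0 < N"
  shows "d_h (N, \<sigma>) (N, \<upsilon>) \<le> d_h (N, \<sigma>) (N, \<tau>) + d_h (N, \<tau>) (N, \<upsilon>)"
proof -
  have "card {i \<in> {1..N}. \<sigma> i \<noteq> \<upsilon> i} \<le> card ({i \<in> {1..N}. \<sigma> i \<noteq> \<tau> i} \<union> {i \<in> {1..N}. \<tau> i \<noteq> \<upsilon> i})"
    by (intro card_mono) auto
  also have "\<dots> \<le> card {i \<in> {1..N}. \<sigma> i \<noteq> \<tau> i} + card {i \<in> {1..N}. \<tau> i \<noteq> \<upsilon> i}"
    by (rule card_Un_le)
  finally show ?thesis using assms by (simp add: d_h_same field_simps flip: of_nat_add)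
qed

lemma d_h_comp_left:
  assumes "inj \<rho>"
  shows "d_h (N, \<rho> \<circ> \<sigma>) (N, \<rho> \<circ> \<tau>) = d_h (N, \<sigma>) (N, \<tau>)"
  using assms by (simp add: d_h_def inj_eq)

lemma d_h_comp_right:
  assumes "\<rho> permutes {1..N}"
  shows "d_h (N, \<sigma> \<circ> \<rho>) (N, \<tau> \<circ> \<rho>) = d_h (N, \<sigma>) (N, \<tau>)"
proof -
  have "bij_betw \<rho> {i \<in> {1..N}. \<sigma> (\<rho> i) = \<tau> (\<rho> i)} {i \<in> {1..N}. \<sigma> i = \<tau> i}"
    using assms permutes_in_image[OF assms] permutes_inj_on[OF assms] permutes_image[OF assms]
    unfolding bij_betw_def by (auto simp: image_iff simp del: atLeastAtMost_iff)
  then show ?thesis by (simp add: d_h_def bij_betw_same_card)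
qed

lemma d_h_commute: "d_h (N, \<sigma>) (N, \<tau>) = d_h (N, \<tau>) (N, \<sigma>)"
proof -
  have "{i \<in> {1..N}. \<sigma> i = \<tau> i} = {i \<in> {1..N}. \<tau> i = \<sigma> i}" by auto
  then show ?thesis by (simp add: d_h_def)
qed

text \<open>Links sums over all ordered triples, which interchange freely, with the increasing
  triples of \<open>cobdry_norm\<close>: a triple without repetition is increasing in exactly one of
  its six orders.\<close>

lemma sum_symmetric_eq:
  fixes h :: "'a::linorder \<Rightarrow> 'a \<Rightarrow> 'a \<Rightarrow> real"
  assumes sym: "\<And>x y z. h x y z = h y x z" "\<And>x y z. h x y z = h x z y"
    and deg: "\<And>x y z. x = y \<Longrightarrow> h x y z = 0"
  shows "(\<Sum>x\<in>V. \<Sum>y\<in>V. \<Sum>z\<in>V. h x y z) = 6 * (\<Sum>x\<in>V. \<Sum>y\<in>V. \<Sum>z\<in>V. of_bool (x < y \<and> y < z) * h x y z)"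
proof -
  define s where "s x y z = of_bool (x < y \<and> y < z) * h x y z" for x y z
  let ?S = "\<Sum>x\<in>V. \<Sum>y\<in>V. \<Sum>z\<in>V. s x y z"
  have "h x y z = s x y z + s x z y + s y x z + s y z x + s z x y + s z y x" for x y z
  proof -
    have e: "h x z y = h x y z" "h y x z = h x y z" "h y z x = h x y z" "h z x y = h x y z" "h z y x = h x y z"
      using sym by metis+
    have "h x y z = 0" if "x = y \<or> y = z \<or> x = z" using that deg e by metis
    then show ?thesis unfolding s_def e
      by (cases x y rule: linorder_cases; cases y z rule: linorder_cases; cases x z rule: linorder_cases) auto
  qed
  then have "(\<Sum>x\<in>V. \<Sum>y\<in>V. \<Sum>z\<in>V. h x y z) = ?S + (\<Sum>x\<in>V. \<Sum>y\<in>V. \<Sum>z\<in>V. s x z y)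
     + (\<Sum>x\<in>V. \<Sum>y\<in>V. \<Sum>z\<in>V. s y x z) + (\<Sum>x\<in>V. \<Sum>y\<in>V. \<Sum>z\<in>V. s y z x)
     + (\<Sum>x\<in>V. \<Sum>y\<in>V. \<Sum>z\<in>V. s z x y) + (\<Sum>x\<in>V. \<Sum>y\<in>V. \<Sum>z\<in>V. s z y x)"
    by (simp add: sum.distrib)
  moreover have 1: "(\<Sum>x\<in>V. \<Sum>y\<in>V. \<Sum>z\<in>V. g x z y) = (\<Sum>x\<in>V. \<Sum>y\<in>V. \<Sum>z\<in>V. g x y z)"
    and 2: "(\<Sum>x\<in>V. \<Sum>y\<in>V. \<Sum>z\<in>V. g y x z) = (\<Sum>x\<in>V. \<Sum>y\<in>V. \<Sum>z\<in>V. g x y z)"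
    for g :: "'a \<Rightarrow> 'a \<Rightarrow> 'a \<Rightarrow> real"
    by (intro sum.cong refl sum.swap, rule sum.swap)
  have 3: "(\<Sum>x\<in>V. \<Sum>y\<in>V. \<Sum>z\<in>V. s y z x) = ?S"
    using 1[of "\<lambda>x y z. s z y x"] 2[of "\<lambda>x y z. s z x y"] 1[of s] 2[of s]
      1[of "\<lambda>x y z. s y x z"] 2[of "\<lambda>x y z. s x z y"] 1[of "\<lambda>x y z. s y z x"] by simp
  have 4: "(\<Sum>x\<in>V. \<Sum>y\<in>V. \<Sum>z\<in>V. s z x y) = ?S"
    using 1[of "\<lambda>x y z. s z x y"] 2[of s] by simp
  have 5: "(\<Sum>x\<in>V. \<Sum>y\<in>V. \<Sum>z\<in>V. s z y x) = ?S"
    using 2[of "\<lambda>x y z. s z x y"] 4 by simp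
  show ?thesis using calculation 1[of s] 2[of s] 3 4 5 by (simp add: s_def)
qed

lemma triangle_eq_iff: "card {x, y, z} = 3 \<longleftrightarrow> distinct [x, y, z]"
  by (auto simp: card_insert_if)

section \<open>Complexes with complete 1-skeleton and triangle set \<open>T\<close>\<close>

context
  fixes n :: nat and T :: "nat set set" and Y :: "nat set set"
  assumes T: "T \<subseteq> all_triangles n" and Y_def: "Y = complete_skeleton n \<union> T"
begin

lemma card_triangle: "t \<in> T \<Longrightarrow> card t = 3"
  using T by (auto simp: all_triangles_def)

lemma triangles_Y: "triangles Y = T"
  using T by (auto simp: triangles_def Y_def complete_skeleton_def all_triangles_def)

lemma edges_Y: "edges Y = {e. e \<subseteq> {1..n} \<and> card e = 2}"
  using T by (auto simp: edges_def Y_def complete_skeleton_def all_triangles_def)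

lemma oriented_edges_Y: "oriented_edges Y = {(x, y). x \<noteq> y \<and> x \<in> {1..n} \<and> y \<in> {1..n}}"
proof -
  have "{x, y} \<in> Y \<longleftrightarrow> x \<in> {1..n} \<and> y \<in> {1..n}" if "x \<noteq> y" for x y
  proof -
    have c: "card {x, y} = 2" using that by simp
    then have "{x, y} \<notin> T" using card_triangle[of "{x, y}"] by linarith
    with c show ?thesis unfolding Y_def complete_skeleton_def by simp
  qed
  then show ?thesis unfolding oriented_edges_def by blast
qed

lemma oriented_triangles_Y: "oriented_triangles Y = {(x, y, z). {x, y, z} \<in> T}"
proof -
  have "x \<noteq> y \<and> y \<noteq> z \<and> z \<noteq> x \<and> {x, y, z} \<in> Y \<longleftrightarrow> {x, y, z} \<in> T" for x y z
  proof -
    have "{x, y, z} \<notin> complete_skeleton n" if "distinct [x, y, z]"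
      using that triangle_eq_iff[of x y z] by (simp add: complete_skeleton_def)
    moreover have "distinct [x, y, z]" if "{x, y, z} \<in> T"
      using card_triangle[OF that] triangle_eq_iff by metis
    moreover have "distinct [x, y, z] \<longleftrightarrow> x \<noteq> y \<and> y \<noteq> z \<and> z \<noteq> x" by auto
    ultimately show ?thesis unfolding Y_def by blast
  qed
  then show ?thesis by (simp add: oriented_triangles_def)
qed

lemma finite_T: "finite T"
  using T by (rule finite_subset) (auto simp: all_triangles_def)

text \<open>Double counting: each triangle has three edges. This makes the denominator of
  \<open>mu1\<close> explicit.\<close>

lemma sum_edge_degrees: "(\<Sum>e\<in>edges Y. real (card {t \<in> triangles Y. e \<subseteq> t})) = 3 * real (card T)"
proof -
  have fin: "finite (edges Y)" unfolding edges_Y by simp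
  have "(\<Sum>e\<in>edges Y. card {t \<in> triangles Y. e \<subseteq> t}) = 3 * card T"
    unfolding triangles_Y
  proof (rule sum_multicount[OF fin finite_T], rule ballI)
    fix t assume t: "t \<in> T"
    then have "t \<subseteq> {1..n}" "card t = 3" using T by (auto simp: all_triangles_def)
    then have "{e \<in> edges Y. e \<subseteq> t} = {e. e \<subseteq> t \<and> card e = 2}" by (auto simp: edges_Y)
    also have "card \<dots> = card t choose 2"
      using \<open>card t = 3\<close> by (intro n_subsets) (auto intro: card_ge_0_finite)
    finally show "card {e \<in> edges Y. e \<subseteq> t} = 3" using \<open>card t = 3\<close> by (simp add: choose_two)
  qed
  then have "real (\<Sum>e\<in>edges Y. card {t \<in> triangles Y. e \<subseteq> t}) = real (3 * card T)"
    by (rule arg_cong)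
  then show ?thesis by simp
qed

lemma mu1_le:
  assumes "x \<noteq> y" "(\<Sum>z\<in>{1..n}. tri T x y z) \<le> D"
  shows "mu1 Y {x, y} \<le> D / (3 * real (card T))"
proof -
  have "{t \<in> T. {x, y} \<subseteq> t} \<subseteq> (\<lambda>z. {x, y, z}) ` {z \<in> {1..n}. {x, y, z} \<in> T}"
  proof
    fix t assume t: "t \<in> {t \<in> T. {x, y} \<subseteq> t}"
    then have "card (t - {x, y}) = 1"
      using card_triangle[of t] assms(1) by (subst card_Diff_subset) auto
    then obtain z where "t - {x, y} = {z}" by (auto simp: card_1_singleton_iff)
    then have "t = {x, y, z}" using t by auto
    then show "t \<in> (\<lambda>z. {x, y, z}) ` {z \<in> {1..n}. {x, y, z} \<in> T}"
      using t T by (auto simp: all_triangles_def)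
  qed
  then have "card {t \<in> T. {x, y} \<subseteq> t} \<le> card {z \<in> {1..n}. {x, y, z} \<in> T}"
    by (rule surj_card_le[rotated]) simp
  also have "real \<dots> = (\<Sum>z\<in>{1..n}. tri T x y z)"
    by (simp add: tri_def of_bool_def sum.If_cases Int_def)
  finally have "real (card {t \<in> T. {x, y} \<subseteq> t}) \<le> D" using assms(2) by simp
  then show ?thesis
    unfolding mu1_def sum_edge_degrees unfolding triangles_Y by (intro divide_right_mono) auto
qed

lemma mu1_nonneg: "0 \<le> mu1 Y e"
  by (simp add: mu1_def sum_nonneg)

text \<open>Meaningful outside \<open>T\<close> too, since all edges are present. The value 0 on
  degenerate triples lets sums run over all triples of vertices.\<close>

definition defect :: "nat \<Rightarrow> nat cochain \<Rightarrow> nat \<Rightarrow> nat \<Rightarrow> nat \<Rightarrow> real" where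
  "defect N \<alpha> x y z = (if distinct [x, y, z] then d_h (N, cobdry \<alpha> (x, y, z)) (N, id) else 0)"

section \<open>Defects and cones of a fixed cochain\<close>

context
  fixes N :: nat and \<alpha> :: "nat cochain"
  assumes N: "2 \<le> N" and \<alpha>: "\<alpha> \<in> cochains Y N"
begin

lemma cochain_permutes: "\<alpha> (x, y) permutes {1..N}" if "x \<noteq> y" "x \<in> {1..n}" "y \<in> {1..n}"
proof -
  have "\<alpha> \<in> oriented_edges Y \<rightarrow>\<^sub>E {\<sigma>. \<sigma> permutes {1..N}}" using \<alpha> by (simp add: cochains_def)
  then have "\<alpha> (x, y) \<in> {\<sigma>. \<sigma> permutes {1..N}}"
    by (rule PiE_mem) (use that in \<open>auto simp: oriented_edges_Y\<close>)
  then show ?thesis by simp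
qed

lemma cochain_swap: "\<alpha> (y, x) = inv (\<alpha> (x, y))" if "x \<noteq> y" "x \<in> {1..n}" "y \<in> {1..n}"
proof -
  have "\<forall>(x, y) \<in> oriented_edges Y. \<alpha> (y, x) = inv (\<alpha> (x, y))" using \<alpha> by (simp add: cochains_def)
  moreover have "(x, y) \<in> oriented_edges Y" using that by (simp add: oriented_edges_Y)
  ultimately show ?thesis by blast
qed

lemma cochain_inverse: "\<alpha> (x, y) \<circ> \<alpha> (y, x) = id" if "x \<noteq> y" "x \<in> {1..n}" "y \<in> {1..n}"
  using permutes_inv_o(1)[OF cochain_permutes[OF that]] cochain_swap[OF that] by simp

lemma defect_nonneg: "0 \<le> defect N \<alpha> x y z"
  by (simp add: defect_def d_h_nonneg)

text \<open>Right multiplication by \<open>\<alpha> (y, z) \<circ> \<alpha> (z, x)\<close> is an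
  isometry that carries the detour through \<open>z\<close> to the identity. So the defect compares
  the edge \<open>x y\<close> with this detour.\<close>

lemma defect_eq:
  assumes "distinct [x, y, z]" "{x, y, z} \<subseteq> {1..n}"
  shows "defect N \<alpha> x y z = d_h (N, \<alpha> (x, y)) (N, \<alpha> (x, z) \<circ> \<alpha> (z, y))"
proof -
  have p: "\<alpha> (y, z) \<circ> \<alpha> (z, x) permutes {1..N}"
    using assms by (intro permutes_compose cochain_permutes) auto
  have "\<alpha> (x, z) \<circ> \<alpha> (z, y) \<circ> (\<alpha> (y, z) \<circ> \<alpha> (z, x)) = \<alpha> (x, z) \<circ> (\<alpha> (z, y) \<circ> \<alpha> (y, z)) \<circ> \<alpha> (z, x)"
    by (simp add: comp_assoc)
  also have "\<dots> = id" using assms cochain_inverse by auto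
  finally show ?thesis
    using assms d_h_comp_right[OF p, of "\<alpha> (x, y)" "\<alpha> (x, z) \<circ> \<alpha> (z, y)"]
    by (simp add: defect_def cobdry_def comp_assoc)
qed

lemma defect_swap:
  assumes "{x, y, z} \<subseteq> {1..n}"
  shows "defect N \<alpha> x y z = defect N \<alpha> x z y" "defect N \<alpha> x y z = defect N \<alpha> y z x"
proof -
  have *: "(x, y) \<in> oriented_edges Y \<and> (y, z) \<in> oriented_edges Y \<and> (z, x) \<in> oriented_edges Y"
    if "distinct [x, y, z]" using that assms by (auto simp: oriented_edges_Y)
  show "defect N \<alpha> x y z = defect N \<alpha> x z y" "defect N \<alpha> x y z = defect N \<alpha> y z x"
    using d_h_cobdry_orientation[OF \<alpha>, of x y z] * by (auto simp: defect_def)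
qed

text \<open>Triangle inequality along the routes \<open>x y\<close>, \<open>x u y\<close>,
  \<open>x z u y\<close>, \<open>x z y\<close>: each move costs the defect of one face, since common
  factors cancel by invariance. If vertices coincide, the left side vanishes or occurs on the
  right.\<close>

lemma defect_tetrahedron:
  assumes V: "{x, y, z, u} \<subseteq> {1..n}"
  shows "defect N \<alpha> x y z \<le> defect N \<alpha> x y u + defect N \<alpha> x z u + defect N \<alpha> y z u"
proof (cases "distinct [x, y, z, u]")
  case True
  have inj: "inj (\<alpha> (x, z))" using True V by (intro permutes_inj[OF cochain_permutes]) auto
  have perm: "\<alpha> (u, y) permutes {1..N}" using True V by (intro cochain_permutes) auto
  have N': "0 < N" using N by simp
  have "defect N \<alpha> x y z = d_h (N, \<alpha> (x, y)) (N, \<alpha> (x, z) \<circ> \<alpha> (z, y))"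
    using True V by (intro defect_eq) auto
  also have "\<dots> \<le> d_h (N, \<alpha> (x, y)) (N, \<alpha> (x, u) \<circ> \<alpha> (u, y))
      + d_h (N, \<alpha> (x, u) \<circ> \<alpha> (u, y)) (N, \<alpha> (x, z) \<circ> \<alpha> (z, y))"
    by (rule d_h_triangle[OF N'])
  also have "d_h (N, \<alpha> (x, u) \<circ> \<alpha> (u, y)) (N, \<alpha> (x, z) \<circ> \<alpha> (z, y))
     \<le> d_h (N, \<alpha> (x, u) \<circ> \<alpha> (u, y)) (N, \<alpha> (x, z) \<circ> \<alpha> (z, u) \<circ> \<alpha> (u, y))
     + d_h (N, \<alpha> (x, z) \<circ> \<alpha> (z, u) \<circ> \<alpha> (u, y)) (N, \<alpha> (x, z) \<circ> \<alpha> (z, y))"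
    by (rule d_h_triangle[OF N'])
  also have "d_h (N, \<alpha> (x, y)) (N, \<alpha> (x, u) \<circ> \<alpha> (u, y)) = defect N \<alpha> x y u"
    using True V by (subst defect_eq) auto
  also have "d_h (N, \<alpha> (x, u) \<circ> \<alpha> (u, y)) (N, \<alpha> (x, z) \<circ> \<alpha> (z, u) \<circ> \<alpha> (u, y)) = defect N \<alpha> x u z"
    using True V by (subst defect_eq) (auto simp: d_h_comp_right[OF perm])
  also have "defect N \<alpha> x u z = defect N \<alpha> x z u"
    using V by (intro defect_swap) auto
  also have "d_h (N, \<alpha> (x, z) \<circ> \<alpha> (z, u) \<circ> \<alpha> (u, y)) (N, \<alpha> (x, z) \<circ> \<alpha> (z, y)) = defect N \<alpha> z y u"
    using True V by (subst defect_eq) (auto simp: comp_assoc d_h_comp_left[OF inj] d_h_commute)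
  also have "defect N \<alpha> z y u = defect N \<alpha> y z u"
    using V defect_swap(1)[of z y u] defect_swap(2)[of z u y] defect_swap(2)[of u y z] by auto
  finally show ?thesis by simp
next
  case False
  consider "\<not> distinct [x, y, z]" | "u = x" "distinct [x, y, z]" | "u = y" "distinct [x, y, z]" | "u = z"
    using False by auto
  then show ?thesis
  proof cases
    case 1
    then have "defect N \<alpha> x y z = 0" by (auto simp: defect_def)
    then show ?thesis using defect_nonneg by simp
  next
    case 2
    have "defect N \<alpha> y z u = defect N \<alpha> x y z" using 2 V by (auto simp: defect_swap(2)[of x y z])
    then show ?thesis using defect_nonneg by simp
  next
    case 3
    have "defect N \<alpha> x z u = defect N \<alpha> x y z" using 3 V by (auto simp: defect_swap(1)[of x y z])
    then show ?thesis using defect_nonneg by simp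
  next
    case 4
    then show ?thesis using defect_nonneg by simp
  qed
qed

lemma cobdry_norm_eq:
  "(\<Sum>x\<in>{1..n}. \<Sum>y\<in>{1..n}. \<Sum>z\<in>{1..n}. tri T x y z * defect N \<alpha> x y z)
    = 6 * real (card T) * cobdry_norm Y (N, \<alpha>)"
proof (cases "T = {}")
  case False
  let ?V = "{1..n}"
  \<comment> \<open>\<open>defect_swap\<close> holds for vertices only; cutting off elsewhere makes
    \<open>?h\<close> symmetric everywhere.\<close>
  let ?h = "\<lambda>x y z. if {x, y, z} \<subseteq> ?V then tri T x y z * defect N \<alpha> x y z else 0"
  have "(\<Sum>x\<in>?V. \<Sum>y\<in>?V. \<Sum>z\<in>?V. tri T x y z * defect N \<alpha> x y z) = (\<Sum>x\<in>?V. \<Sum>y\<in>?V. \<Sum>z\<in>?V. ?h x y z)"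
    by (intro sum.cong refl) auto
  also have "\<dots> = 6 * (\<Sum>x\<in>?V. \<Sum>y\<in>?V. \<Sum>z\<in>?V. of_bool (x < y \<and> y < z) * ?h x y z)"
  proof (rule sum_symmetric_eq)
    show "?h x y z = ?h x z y" for x y z
      using defect_swap(1)[of x y z] by (auto simp: tri_def insert_commute)
    show "?h x y z = ?h y x z" for x y z
      using defect_swap(2)[of x y z] defect_swap(1)[of y z x] by (auto simp: tri_def insert_commute)
    show "?h x y z = 0" if "x = y" for x y z
      using that by (simp add: defect_def)
  qed
  also have "(\<Sum>x\<in>?V. \<Sum>y\<in>?V. \<Sum>z\<in>?V. of_bool (x < y \<and> y < z) * ?h x y z)
      = (\<Sum>(x, y, z)\<in>?V \<times> ?V \<times> ?V. of_bool (x < y \<and> y < z) * ?h x y z)"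
    by (simp only: sum.cartesian_product)
  also have "\<dots> = (\<Sum>(x, y, z)\<in>{(x, y, z) \<in> oriented_triangles Y. x < y \<and> y < z}.
        d_h (N, cobdry \<alpha> (x, y, z)) (N, id))"
  proof (rule sum.mono_neutral_cong_right)
    show "{(x, y, z) \<in> oriented_triangles Y. x < y \<and> y < z} \<subseteq> ?V \<times> ?V \<times> ?V"
      using T by (auto simp: oriented_triangles_Y all_triangles_def)
  qed (use T in \<open>auto simp: oriented_triangles_Y tri_def defect_def all_triangles_def\<close>)
  also have "\<dots> = real (card T) * cobdry_norm Y (N, \<alpha>)"
    using False finite_T by (simp add: cobdry_norm_def triangles_Y)
  finally show ?thesis by simp
qed (simp add: tri_def)

text \<open>\<open>\<phi>\<close> is the coboundary of the 0-cochain \<open>g\<close>, so its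
  product around a triangle telescopes. On \<open>x y\<close> it is the detour through the apex
  \<open>v\<close>, and \<open>defect_eq\<close> applies.\<close>

lemma cone_cocycle:
  assumes v: "v \<in> {1..n}"
  obtains \<phi> where "\<phi> \<in> cocycles Y N"
    "\<And>x y. x \<in> {1..n} \<Longrightarrow> y \<in> {1..n} \<Longrightarrow> x \<noteq> y \<Longrightarrow> d_h (N, \<alpha> (x, y)) (N, \<phi> (x, y)) = defect N \<alpha> x y v"
proof
  \<comment> \<open>The value \<open>id\<close> at the apex makes \<open>\<phi>\<close> agree with
    \<open>\<alpha>\<close> on edges at \<open>v\<close>, where the defect is 0.\<close>
  define g where "g x = (if x = v then id else \<alpha> (x, v))" for x
  define \<phi> where "\<phi> = restrict (\<lambda>(x, y). g x \<circ> inv (g y)) (oriented_edges Y)"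
  have g: "g x permutes {1..N}" if "x \<in> {1..n}" for x
    using that v cochain_permutes by (auto simp: g_def)
  have inv_g: "inv (g x) \<circ> g x = id" if "x \<in> {1..n}" for x
    using permutes_inv_o(2)[OF g[OF that]] .
  have \<phi>: "\<phi> (x, y) = g x \<circ> inv (g y)" if "x \<in> {1..n}" "y \<in> {1..n}" "x \<noteq> y" for x y
    using that by (simp add: \<phi>_def oriented_edges_Y)
  have "\<phi> \<in> cochains Y N"
    unfolding cochains_def
  proof (intro CollectI conjI)
    show "\<phi> \<in> oriented_edges Y \<rightarrow>\<^sub>E {\<sigma>. \<sigma> permutes {1..N}}"
      using g by (auto simp: \<phi>_def oriented_edges_Y intro!: permutes_compose permutes_inv)
    show "\<forall>(x, y) \<in> oriented_edges Y. \<phi> (y, x) = inv (\<phi> (x, y))"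
    proof (clarify, unfold oriented_edges_Y, clarify)
      fix x y assume xy: "x \<noteq> y" "x \<in> {1..n}" "y \<in> {1..n}"
      have "inv (g x \<circ> inv (g y)) = inv (inv (g y)) \<circ> inv (g x)"
        using xy by (intro o_inv_distrib permutes_bij[OF g] permutes_bij[OF permutes_inv[OF g]])
      then show "\<phi> (y, x) = inv (\<phi> (x, y))"
        using xy by (simp add: \<phi> permutes_inv_inv[OF g])
    qed
  qed
  moreover have "cobdry \<phi> (x, y, z) = id" if "{x, y, z} \<in> T" for x y z
  proof -
    have xyz: "{x, y, z} \<subseteq> {1..n}" "distinct [x, y, z]"
      using that T card_triangle[OF that] triangle_eq_iff[of x y z] by (auto simp: all_triangles_def)
    have "cobdry \<phi> (x, y, z) = g x \<circ> (inv (g y) \<circ> g y) \<circ> (inv (g z) \<circ> g z) \<circ> inv (g x)"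
      using xyz by (simp add: cobdry_def \<phi> comp_assoc)
    also have "\<dots> = id"
      using xyz inv_g[of y] inv_g[of z] permutes_inv_o(1)[OF g, of x] by simp
    finally show ?thesis .
  qed
  ultimately show "\<phi> \<in> cocycles Y N"
    by (auto simp: cocycles_def oriented_triangles_Y)
  fix x y assume xy: "x \<in> {1..n}" "y \<in> {1..n}" "x \<noteq> y"
  have inv: "inv (\<alpha> (y, v)) = \<alpha> (v, y)" if "y \<noteq> v"
    using cochain_swap[of y v] that xy v by simp
  consider "x = v" | "y = v" | "distinct [x, y, v]" using xy by auto
  then show "d_h (N, \<alpha> (x, y)) (N, \<phi> (x, y)) = defect N \<alpha> x y v"
  proof cases
    case 1
    then show ?thesis using N xy inv by (simp add: \<phi> g_def defect_def d_h_same)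
  next
    case 2
    then show ?thesis using N xy by (simp add: \<phi> g_def defect_def d_h_same)
  next
    case 3
    then show ?thesis using xy v inv by (subst defect_eq) (auto simp: \<phi> g_def)
  qed
qed

lemma cochain_dist_nonneg: "0 \<le> cochain_dist Y \<beta> \<phi>"
  by (cases \<beta>; cases \<phi>) (auto simp: cochain_dist_def mu1_nonneg d_h_nonneg intro!: sum_nonneg)

text \<open>A cone shows that the real infimum is taken over a nonempty set.\<close>

lemma dist_Z1_nonneg: "0 \<le> dist_Z1 Y (N, \<alpha>)" if "0 < n"
proof -
  have "1 \<in> {1..n}" using that by simp
  then obtain \<phi> where "\<phi> \<in> cocycles Y N" by (rule cone_cocycle)
  then have "(N, \<phi>) \<in> Z1_Sym Y" using N by (simp add: Z1_Sym_def)
  then have "Z1_Sym Y \<noteq> {}" by blast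
  then show ?thesis unfolding dist_Z1_def by (intro cINF_greatest) (auto simp: cochain_dist_nonneg)
qed

text \<open>Each apex gives a cone to compare with; adding up over all \<open>n\<close> apexes
  produces the total defect.\<close>

lemma dist_Z1_le:
  assumes "0 \<le> m" and m: "\<And>x y. x \<in> {1..n} \<Longrightarrow> y \<in> {1..n} \<Longrightarrow> x \<noteq> y \<Longrightarrow> mu1 Y {x, y} \<le> m"
  shows "real n * dist_Z1 Y (N, \<alpha>) \<le> m * (\<Sum>x\<in>{1..n}. \<Sum>y\<in>{1..n}. \<Sum>z\<in>{1..n}. defect N \<alpha> x y z)"
proof -
  let ?V = "{1..n}"
  have "dist_Z1 Y (N, \<alpha>) \<le> (\<Sum>x\<in>?V. \<Sum>y\<in>?V. m * defect N \<alpha> x y v)" if v: "v \<in> ?V" for v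
  proof -
    obtain \<phi> where \<phi>: "\<phi> \<in> cocycles Y N"
      and d: "\<And>x y. x \<in> {1..n} \<Longrightarrow> y \<in> {1..n} \<Longrightarrow> x \<noteq> y \<Longrightarrow> d_h (N, \<alpha> (x, y)) (N, \<phi> (x, y)) = defect N \<alpha> x y v"
      using cone_cocycle[OF v] by blast
    have "dist_Z1 Y (N, \<alpha>) \<le> cochain_dist Y (N, \<alpha>) (N, \<phi>)"
      unfolding dist_Z1_def using \<phi> N cochain_dist_nonneg
      by (intro cINF_lower bdd_belowI2[of _ 0]) (auto simp: Z1_Sym_def)
    also have "\<dots> = (\<Sum>(x, y)\<in>{(x, y) \<in> oriented_edges Y. x < y}. mu1 Y {x, y} * defect N \<alpha> x y v)"
      unfolding cochain_dist_def by (auto simp: oriented_edges_Y d intro!: sum.cong)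
    also have "\<dots> \<le> (\<Sum>(x, y)\<in>{(x, y) \<in> oriented_edges Y. x < y}. m * defect N \<alpha> x y v)"
      using m defect_nonneg by (intro sum_mono) (auto simp: oriented_edges_Y intro!: mult_right_mono)
    \<comment> \<open>Counting both orientations of every edge gives away a factor 2.\<close>
    also have "\<dots> \<le> (\<Sum>(x, y)\<in>?V \<times> ?V. m * defect N \<alpha> x y v)"
      using assms(1) defect_nonneg by (intro sum_mono2) (auto simp: oriented_edges_Y)
    finally show ?thesis by (simp add: sum.cartesian_product)
  qed
  then have "(\<Sum>v\<in>?V. dist_Z1 Y (N, \<alpha>)) \<le> (\<Sum>v\<in>?V. \<Sum>x\<in>?V. \<Sum>y\<in>?V. m * defect N \<alpha> x y v)"
    by (rule sum_mono)
  also have "\<dots> = (\<Sum>x\<in>?V. \<Sum>v\<in>?V. \<Sum>y\<in>?V. m * defect N \<alpha> x y v)" by (rule sum.swap)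
  also have "\<dots> = (\<Sum>x\<in>?V. \<Sum>y\<in>?V. \<Sum>v\<in>?V. m * defect N \<alpha> x y v)"
    by (intro sum.cong refl sum.swap)
  finally show ?thesis by (simp add: sum_distrib_left)
qed

end

text \<open>The deterministic criterion: \<open>sum_defect_le\<close> bounds the total defect by the
  coboundary norm, \<open>dist_Z1_le\<close> the distance by the total defect. The factors
  \<open>card T\<close> cancel, and \<open>6 / 3\<close> is the 2 in \<open>bound\<close>.\<close>

lemma h1_Sym_ge:
  assumes n: "0 < n" and c: "0 < c"
    and deg: "\<And>x y. x \<in> {1..n} \<Longrightarrow> y \<in> {1..n} \<Longrightarrow> x \<noteq> y \<Longrightarrow> (\<Sum>z\<in>{1..n}. tri T x y z) \<le> D1"
    and load: "\<And>i x z u. i < k \<Longrightarrow> {x, z, u} \<subseteq> {1..n} \<Longrightarrow> distinct [x, z, u] \<Longrightarrow>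
      (\<Sum>y\<in>{1..n}. tri T y z u * closed_path_sum {1..n} T x y i {x, y, z} u) \<le> D ^ Suc i"
    and D: "0 \<le> D" and D1: "0 \<le> D1"
    and q: "\<And>x y z. {x, y, z} \<subseteq> {1..n} \<Longrightarrow> distinct [x, y, z] \<Longrightarrow> q \<le> closed_path_sum {1..n} T x y k {x, y} z"
    and q0: "0 < q"
    and bound: "c * (2 * D1 * (real (2 * k + 1) * D ^ k)) \<le> real n * q"
  shows "ereal c \<le> h1_Sym Y"
  unfolding h1_Sym_def
proof (rule INF_greatest)
  fix \<beta> assume "\<beta> \<in> {\<beta> \<in> C1_Sym Y. cobdry_norm Y \<beta> \<noteq> 0}"
  then obtain N \<alpha> where \<beta>: "\<beta> = (N, \<alpha>)" and N: "2 \<le> N" and \<alpha>: "\<alpha> \<in> cochains Y N"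
    and ne: "cobdry_norm Y (N, \<alpha>) \<noteq> 0"
    by (auto simp: C1_Sym_def)
  let ?e = "cobdry_norm Y (N, \<alpha>)" and ?d = "dist_Z1 Y (N, \<alpha>)"
  let ?S = "\<Sum>x\<in>{1..n}. \<Sum>y\<in>{1..n}. \<Sum>z\<in>{1..n}. defect N \<alpha> x y z"
  have T0: "0 < card T" using ne by (auto simp: cobdry_norm_def triangles_Y card_gt_0_iff)
  have e0: "0 \<le> ?e" by (auto simp: cobdry_norm_def d_h_nonneg intro!: divide_nonneg_nonneg sum_nonneg)
  have "q * ?S \<le> real (2 * k + 1) * D ^ k * (6 * real (card T) * ?e)"
    unfolding cobdry_norm_eq[OF N \<alpha>, symmetric]
  proof (rule sum_defect_le[OF _ card_triangle _ _ _ load D q])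
    show "defect N \<alpha> x y z = 0" if "x = y \<or> y = z \<or> x = z" for x y z
      using that by (auto simp: defect_def)
  qed (use defect_nonneg[OF N \<alpha>] defect_tetrahedron[OF N \<alpha>] in auto)
  moreover have "real n * ?d \<le> D1 / (3 * real (card T)) * ?S"
    using D1 deg by (intro dist_Z1_le[OF N \<alpha>] mu1_le) auto
  ultimately have "q * (real n * ?d) \<le> D1 / (3 * real (card T)) * (real (2 * k + 1) * D ^ k * (6 * real (card T) * ?e))"
    using q0 D1 mult_left_mono[of "real n * ?d" "D1 / (3 * real (card T)) * ?S" q]
      mult_left_mono[of "q * ?S" "real (2 * k + 1) * D ^ k * (6 * real (card T) * ?e)" "D1 / (3 * real (card T))"]
    by (simp add: mult_ac)
  also have "\<dots> = 2 * D1 * (real (2 * k + 1) * D ^ k) * ?e" using T0 by (simp add: field_simps)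
  finally have "c * (real n * q) * ?d \<le> c * (2 * D1 * (real (2 * k + 1) * D ^ k)) * ?e"
    using mult_left_mono[of _ _ c] c by (simp add: mult_ac)
  also have "\<dots> \<le> (real n * q) * ?e" using bound e0 by (rule mult_right_mono)
  finally have "(real n * q) * (c * ?d) \<le> (real n * q) * ?e" by (simp add: mult_ac)
  then have le: "c * ?d \<le> ?e" using q0 n by simp
  show "ereal c \<le> ereal (cobdry_norm Y \<beta>) / ereal (dist_Z1 Y \<beta>)"
  proof (cases "?d = 0")
    \<comment> \<open>A positive norm over distance 0 is infinite in \<open>ereal\<close>.\<close>
    case True
    then show ?thesis using e0 ne by (simp add: \<beta> divide_ereal_def)
  next
    case False
    then have "0 < ?d" using dist_Z1_nonneg[OF N \<alpha> n] by simp
    then show ?thesis using le by (simp add: \<beta> field_simps)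
  qed
qed

end

section \<open>Concentration of path counts\<close>

lemma tri_Diff: "{x, y, z} \<notin> S \<Longrightarrow> tri (T - S) x y z = tri T x y z"
  by (simp add: tri_def)

lemma measure_pmf_UN_le:
  assumes "finite I" "\<And>i. i \<in> I \<Longrightarrow> measure_pmf.prob M (E i) \<le> c"
  shows "measure_pmf.prob M (\<Union>i\<in>I. E i) \<le> real (card I) * c"
proof -
  have "measure_pmf.prob M (\<Union>i\<in>I. E i) \<le> (\<Sum>i\<in>I. measure_pmf.prob M (E i))"
    using assms(1) by (intro measure_pmf.finite_measure_subadditive_finite) auto
  also have "\<dots> \<le> (\<Sum>i\<in>I. c)" using assms by (intro sum_mono)
  finally show ?thesis by simp
qed

lemma measure_pmf_Un_le:
  assumes "measure_pmf.prob M E \<le> a" "measure_pmf.prob M F \<le> b"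
  shows "measure_pmf.prob M (E \<union> F) \<le> a + b"
  using assms measure_Un_le[of E "measure_pmf M" F] by simp

text \<open>\<open>D1\<close> and \<open>D\<close> bound the numbers of neighbours in links and in the graphs of \<^const>\<open>path_sum\<close>,
  \<open>d0\<close> bounds the latter from below, and \<open>(2 * s) ^ j\<close> bounds the number of paths of length \<open>j\<close>
  between two given vertices. Every single bad event has probability at most \<open>exp (- e)\<close>.\<close>

locale random_complex =
  fixes n k :: nat and p d s e d0 D1 D L2 :: real
  assumes p: "0 < p" "p \<le> 1 / 2" and d: "0 < d" "d \<le> 1" and s: "1 \<le> s" and k: "0 < k"
    and D1: "D1 = (1 + d) * p * real n" and D: "D = (1 + d) * p * D1"
    and L2: "L2 = (1 - d) * p * (real n - 2) - 1"
    and d0: "0 \<le> d0" "d0 + real (k + 2) \<le> (1 - d) * p * L2"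
    and short: "\<And>j. j < k \<Longrightarrow> p * D ^ j \<le> s * (2 * s) ^ j"
    and e: "e \<le> d\<^sup>2 * p * L2 / 4" "e \<le> s / 4" "e \<le> p * d0 ^ k / (16 * (2 * s) ^ k)"
begin

abbreviation "V \<equiv> {1..n}"
abbreviation "\<P> \<equiv> random_subset (all_triangles n) p"

lemma p0: "0 \<le> p" and p1: "p \<le> 1" using p by auto

lemma D1_nonneg: "0 \<le> D1" and D_nonneg: "0 \<le> D"
  using p d by (auto simp: D1 D)

lemma finite_all_triangles: "finite (all_triangles n)"
  by (simp add: all_triangles_def)

lemma card_all_triangles: "T \<subseteq> all_triangles n \<Longrightarrow> t \<in> T \<Longrightarrow> card t = 3"
  by (auto simp: all_triangles_def)

text \<open>The positive codegree bound forces \<open>L2 > 0\<close>, and then \<open>L2\<close> is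
  at most \<open>n - 2\<close> and \<open>D1\<close>; so the first condition in \<open>e\<close>
  covers all these exponents.\<close>

lemma exponents:
  "e \<le> d\<^sup>2 * p * real n / (4 * 1)" "e \<le> d\<^sup>2 * p * (real n - 2) / (4 * 1)" "e \<le> d\<^sup>2 * p * D1 / 4"
proof -
  have *: "x \<le> e' \<Longrightarrow> d\<^sup>2 * p * x / 4 \<le> d\<^sup>2 * p * e' / 4" for x e'
    using p by (intro divide_right_mono mult_left_mono) auto
  have dp: "0 \<le> (1 - d) * p" using p d by simp
  have "0 < (1 - d) * p * L2" using d0 by linarith
  then have "0 < L2" using dp by (auto simp: zero_less_mult_iff)
  then have "0 < (1 - d) * p * (real n - 2)" by (simp add: L2)
  then have 0: "0 \<le> real n - 2" using dp by (auto simp: zero_less_mult_iff)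
  have "(1 - d) * p * (real n - 2) \<le> 1 * 1 * (real n - 2)"
    using 0 p d by (intro mult_mono mult_right_mono) auto
  then have 1: "L2 \<le> real n - 2" by (simp add: L2)
  have "(1 - d) * p * (real n - 2) \<le> (1 + d) * p * real n"
    using 0 p d by (intro mult_mono) auto
  then have 2: "L2 \<le> D1" by (simp add: L2 D1)
  show "e \<le> d\<^sup>2 * p * real n / (4 * 1)" "e \<le> d\<^sup>2 * p * (real n - 2) / (4 * 1)" "e \<le> d\<^sup>2 * p * D1 / 4"
    using e(1) *[OF 1] *[OF 2] *[of L2 "real n"] 1 by simp_all
qed

lemma tri_family:
  assumes "u \<in> V" "v \<in> V" "u \<noteq> v" "U \<subseteq> V - {u, v}"
  shows "finite U" "inj_on (\<lambda>y. {y, u, v}) U" "(\<lambda>y. {y, u, v}) ` U \<subseteq> all_triangles n"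
proof -
  show "finite U" using assms(4) by (rule finite_subset) simp
  show "inj_on (\<lambda>y. {y, u, v}) U"
  proof (rule inj_onI)
    fix y y' assume "y \<in> U" "y' \<in> U" and eq: "{y, u, v} = {y', u, v}"
    then have "y \<notin> {u, v}" using assms(4) by blast
    moreover have "y \<in> {y', u, v}" using eq by blast
    ultimately show "y = y'" by blast
  qed
  show "(\<lambda>y. {y, u, v}) ` U \<subseteq> all_triangles n"
  proof
    fix t assume "t \<in> (\<lambda>y. {y, u, v}) ` U"
    then obtain y where "t = {y, u, v}" "y \<in> V - {u, v}" using assms(4) by blast
    then show "t \<in> all_triangles n" using assms(1-3) by (simp add: all_triangles_def)
  qed
qed

section \<open>The bad events\<close>

definition bad_degree_high :: "nat \<Rightarrow> nat \<Rightarrow> nat set set set" where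
  "bad_degree_high x y = {T. x \<noteq> y \<and> (1 + d) * p * real n \<le> (\<Sum>z\<in>V - {x, y}. tri T z x y)}"

definition bad_degree_low :: "nat \<Rightarrow> nat \<Rightarrow> nat set set set" where
  "bad_degree_low x y = {T. x \<noteq> y \<and> (\<Sum>z\<in>V - {x, y}. tri T z x y) \<le> (1 - d) * p * (real n - 2)}"

text \<open>Here and below, the required bounds on the weights are conjuncts of the event itself.
  Its probability is thus bounded outright, while for a good \<open>T\<close> the bounds are proved
  separately and the event then excludes a deviation of the last sum.\<close>

definition bad_codegree_low :: "nat \<Rightarrow> nat \<Rightarrow> nat \<Rightarrow> nat set set set" where
  "bad_codegree_low x z u = {T. distinct [x, z, u] \<and> L2 \<le> (\<Sum>y\<in>V - {x, z, u}. tri T x y u) \<and>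
     (\<Sum>y\<in>V - {x, z, u}. tri T x y u * tri T y z u) \<le> (1 - d) * p * L2}"

text \<open>The last sum concerns fillings of loops \<open>x y z\<close>, over all \<open>y\<close>,
  whose path starts with \<open>z u\<close>; all of them use \<open>x z u\<close>.\<close>

definition bad_load :: "nat \<Rightarrow> nat \<Rightarrow> nat \<Rightarrow> nat \<Rightarrow> nat set set set" where
  "bad_load i x z u = {T. distinct [x, z, u] \<and>
     (\<forall>y\<in>V - {x, z, u}. closed_path_sum V T x y i {x, y, z} u \<le> D ^ i) \<and>
     (\<Sum>y\<in>V - {x, z, u}. closed_path_sum V T x y i {x, y, z} u) \<le> D1 * D ^ i \<and>
     (1 + d) * p * (D1 * D ^ i) \<le> (\<Sum>y\<in>V - {x, z, u}. closed_path_sum V T x y i {x, y, z} u * tri T y z u)}"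

abbreviation paths :: "nat set set \<Rightarrow> nat \<Rightarrow> nat \<Rightarrow> nat \<Rightarrow> nat \<Rightarrow> nat set \<Rightarrow> nat \<Rightarrow> real" where
  "paths T x y v \<equiv> path_sum V T x y (\<lambda>w. of_bool (w = v))"

text \<open>A step from \<open>u\<close> to \<open>w\<close> needs both \<open>w x u\<close> and
  \<open>w y u\<close>. The first family is exposed here, the second in \<open>bad_paths2\<close>.
  Relative deviation 1 yields the exponent \<open>s / 4\<close> in both.\<close>

definition bad_paths1 :: "nat \<Rightarrow> nat \<Rightarrow> nat \<Rightarrow> nat \<Rightarrow> nat \<Rightarrow> nat set set set" where
  "bad_paths1 j x y u v = {T. distinct [x, y, u] \<and>
     (\<forall>w\<in>V - {x, y, u}. paths T x y v j {x, y, u} w \<le> (2 * s) ^ j) \<and>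
     (\<Sum>w\<in>V - {x, y, u}. paths T x y v j {x, y, u} w) \<le> s * (2 * s) ^ j / p \<and>
     (1 + 1) * p * (s * (2 * s) ^ j / p) \<le> (\<Sum>w\<in>V - {x, y, u}. paths T x y v j {x, y, u} w * tri T w x u)}"

definition bad_paths2 :: "nat \<Rightarrow> nat \<Rightarrow> nat \<Rightarrow> nat \<Rightarrow> nat \<Rightarrow> nat set set set" where
  "bad_paths2 j x y u v = {T. distinct [x, y, u] \<and>
     (\<forall>w\<in>V - {x, y, u}. paths T x y v j {x, y, u} w * tri T w x u \<le> (2 * s) ^ j) \<and>
     (\<Sum>w\<in>V - {x, y, u}. paths T x y v j {x, y, u} w * tri T w x u) \<le> s * (2 * s) ^ j / p \<and>
     (1 + 1) * p * (s * (2 * s) ^ j / p)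
       \<le> (\<Sum>w\<in>V - {x, y, u}. paths T x y v j {x, y, u} w * tri T w x u * tri T w y u)}"

text \<open>Relative deviation \<open>1 / 2\<close> keeps half of the mean and produces the 16 in
  the third condition of \<open>e\<close>.\<close>

definition bad_closing :: "nat \<Rightarrow> nat \<Rightarrow> nat \<Rightarrow> nat set set set" where
  "bad_closing x y z = {T. distinct [x, y, z] \<and>
     (\<forall>w\<in>V - {x, y}. paths T x y w k {x, y} z \<le> (2 * s) ^ k) \<and>
     d0 ^ k \<le> (\<Sum>w\<in>V - {x, y}. paths T x y w k {x, y} z) \<and>
     (\<Sum>w\<in>V - {x, y}. paths T x y w k {x, y} z * tri T w x y) \<le> (1 - 1 / 2) * p * d0 ^ k}"

section \<open>Probabilities of the bad events\<close>

lemma prob_bad_degree_high: "x \<in> V \<Longrightarrow> y \<in> V \<Longrightarrow> measure_pmf.prob \<P> (bad_degree_high x y) \<le> exp (- e)"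
proof (cases "x = y")
  case False
  assume xy: "x \<in> V" "y \<in> V"
  have c: "real (card (V - {x, y})) \<le> real n"
    using card_mono[of V "V - {x, y}"] by simp
  have "measure_pmf.prob \<P> (bad_degree_high x y) \<le> exp (- (d\<^sup>2 * p * real n / (4 * 1)))"
    by (rule order_trans[OF measure_pmf.finite_measure_mono random_subset_upper_tail[OF
          finite_all_triangles p0 p1 tri_family[OF xy False, of "V - {x, y}"],
          where a = "\<lambda>_ _. 1" and d = d and L = "real n" and M = 1]])
      (use d c in \<open>auto simp: bad_degree_high_def tri_def\<close>)
  also have "\<dots> \<le> exp (- e)" using exponents by simp
  finally show ?thesis .
qed (simp add: bad_degree_high_def)

lemma prob_bad_degree_low: "x \<in> V \<Longrightarrow> y \<in> V \<Longrightarrow> measure_pmf.prob \<P> (bad_degree_low x y) \<le> exp (- e)"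
proof (cases "x = y")
  case False
  assume xy: "x \<in> V" "y \<in> V"
  have c: "real n - 2 \<le> real (card (V - {x, y}))"
    using diff_card_le_card_Diff[of "{x, y}" V] False by simp
  have "measure_pmf.prob \<P> (bad_degree_low x y) \<le> exp (- (d\<^sup>2 * p * (real n - 2) / (4 * 1)))"
    by (rule order_trans[OF measure_pmf.finite_measure_mono random_subset_lower_tail[OF
          finite_all_triangles p0 p1 tri_family[OF xy False, of "V - {x, y}"],
          where a = "\<lambda>_ _. 1" and d = d and L = "real n - 2" and M = 1]])
      (use d c in \<open>auto simp: bad_degree_low_def tri_def\<close>)
  also have "\<dots> \<le> exp (- e)" using exponents by simp
  finally show ?thesis .
qed (simp add: bad_degree_low_def)

lemma prob_bad_codegree_low:
  "x \<in> V \<Longrightarrow> z \<in> V \<Longrightarrow> u \<in> V \<Longrightarrow> measure_pmf.prob \<P> (bad_codegree_low x z u) \<le> exp (- e)"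
proof (cases "distinct [x, z, u]")
  case True
  assume xy: "x \<in> V" "z \<in> V" "u \<in> V"
  have zu: "z \<noteq> u" using True by simp
  have indep: "tri (T - (\<lambda>y. {y, z, u}) ` (V - {x, z, u})) x y u = tri T x y u"
    if "y \<in> V - {x, z, u}" for T y
    using True that by (intro tri_Diff) (auto simp: set_eq_iff)
  have "measure_pmf.prob \<P> (bad_codegree_low x z u) \<le> exp (- (d\<^sup>2 * p * L2 / (4 * 1)))"
    by (rule order_trans[OF measure_pmf.finite_measure_mono random_subset_lower_tail[OF
          finite_all_triangles p0 p1 tri_family[OF xy(2,3) zu, of "V - {x, z, u}"],
          where a = "\<lambda>T y. tri T x y u" and d = d and L = L2 and M = 1]])
      (use d indep in \<open>auto simp: bad_codegree_low_def tri_def[of _ _ z u]\<close>)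
  also have "\<dots> \<le> exp (- e)" using e by simp
  finally show ?thesis .
qed (auto simp: bad_codegree_low_def)

lemma prob_bad_load:
  "x \<in> V \<Longrightarrow> z \<in> V \<Longrightarrow> u \<in> V \<Longrightarrow> measure_pmf.prob \<P> (bad_load i x z u) \<le> exp (- e)"
proof (cases "distinct [x, z, u]")
  case True
  assume xy: "x \<in> V" "z \<in> V" "u \<in> V"
  have zu: "z \<noteq> u" using True by simp
  have D0: "0 < D" using xy p d by (auto simp: D D1)
  \<comment> \<open>The paths avoid \<open>z\<close>, whereas every exposed triangle contains
    \<open>z\<close>; this is the purpose of \<open>z\<close> in the forbidden set.\<close>
  have indep: "closed_path_sum V (T - (\<lambda>y. {y, z, u}) ` (V - {x, z, u})) x y i {x, y, z} u
     = closed_path_sum V T x y i {x, y, z} u" if "y \<in> V - {x, z, u}" for T y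
  proof (rule path_sum_cong, intro conjI)
    fix a b assume ab: "a \<in> V - {x, y, z} \<union> {u}" "b \<in> V - insert u {x, y, z}"
    have z: "z \<notin> {x, a, b}" "z \<notin> {y, a, b}" using ab True that by auto
    show "tri (T - (\<lambda>y. {y, z, u}) ` (V - {x, z, u})) x a b = tri T x a b"
      "tri (T - (\<lambda>y. {y, z, u}) ` (V - {x, z, u})) y a b = tri T y a b"
      using z by (intro tri_Diff; blast)+
  next
    fix a assume a: "a \<in> V - {x, y, z} \<union> {u}"
    then have "z \<notin> {x, y, a}" using True that by auto
    then show "tri (T - (\<lambda>y. {y, z, u}) ` (V - {x, z, u})) x y a = tri T x y a"
      by (intro tri_Diff) blast
  qed
  have nn: "0 \<le> closed_path_sum V T x y i {x, y, z} u" for T y by (rule path_sum_nonneg) simp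
  have "measure_pmf.prob \<P> (bad_load i x z u) \<le> exp (- (d\<^sup>2 * p * (D1 * D ^ i) / (4 * D ^ i)))"
    by (rule order_trans[OF measure_pmf.finite_measure_mono random_subset_upper_tail[OF
          finite_all_triangles p0 p1 tri_family[OF xy(2,3) zu, of "V - {x, z, u}"],
          where a = "\<lambda>T y. closed_path_sum V T x y i {x, y, z} u" and d = d and L = "D1 * D ^ i" and M = "D ^ i"]])
      (use d indep D0 nn in \<open>auto simp: bad_load_def tri_def[of _ _ z u]\<close>)
  also have "\<dots> \<le> exp (- e)" using exponents D0 by simp
  finally show ?thesis .
qed (auto simp: bad_load_def)

lemma prob_bad_paths1:
  "x \<in> V \<Longrightarrow> y \<in> V \<Longrightarrow> u \<in> V \<Longrightarrow> measure_pmf.prob \<P> (bad_paths1 j x y u v) \<le> exp (- e)"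
proof (cases "distinct [x, y, u]")
  case True
  assume xy: "x \<in> V" "y \<in> V" "u \<in> V"
  have xu: "x \<noteq> u" using True by simp
  \<comment> \<open>The paths never visit \<open>u\<close>, which every exposed triangle
    contains.\<close>
  have indep: "paths (T - (\<lambda>w. {w, x, u}) ` (V - {x, y, u})) x y v j {x, y, u} w
     = paths T x y v j {x, y, u} w" if "w \<in> V - {x, y, u}" for T w
  proof (rule path_sum_cong, intro conjI)
    fix a b assume ab: "a \<in> V - {x, y, u} \<union> {w}" "b \<in> V - insert w {x, y, u}"
    have z: "u \<notin> {x, a, b}" "u \<notin> {y, a, b}" using ab True that by auto
    show "tri (T - (\<lambda>w. {w, x, u}) ` (V - {x, y, u})) x a b = tri T x a b"
      "tri (T - (\<lambda>w. {w, x, u}) ` (V - {x, y, u})) y a b = tri T y a b"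
      using z by (intro tri_Diff; blast)+
  qed simp
  have nn: "0 \<le> paths T x y v j {x, y, u} w" for T w by (rule path_sum_nonneg) simp
  have "measure_pmf.prob \<P> (bad_paths1 j x y u v) \<le> exp (- (1\<^sup>2 * p * (s * (2 * s) ^ j / p) / (4 * (2 * s) ^ j)))"
    by (rule order_trans[OF measure_pmf.finite_measure_mono random_subset_upper_tail[OF
          finite_all_triangles p0 p1 tri_family[OF xy(1,3) xu, of "V - {x, y, u}"],
          where a = "\<lambda>T w. paths T x y v j {x, y, u} w" and d = 1 and L = "s * (2 * s) ^ j / p" and M = "(2 * s) ^ j"]])
      (use s indep nn in \<open>auto simp: bad_paths1_def tri_def[of _ _ x u]\<close>)
  also have "\<dots> \<le> exp (- e)" using e s p by simp
  finally show ?thesis .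
qed (auto simp: bad_paths1_def)

lemma prob_bad_paths2:
  "x \<in> V \<Longrightarrow> y \<in> V \<Longrightarrow> u \<in> V \<Longrightarrow> measure_pmf.prob \<P> (bad_paths2 j x y u v) \<le> exp (- e)"
proof (cases "distinct [x, y, u]")
  case True
  assume xy: "x \<in> V" "y \<in> V" "u \<in> V"
  have yu: "y \<noteq> u" using True by simp
  \<comment> \<open>As in the first round, and the factor \<open>tri T w x u\<close> is unaffected
    because its triangle lacks \<open>y\<close>.\<close>
  have indep: "paths (T - (\<lambda>w. {w, y, u}) ` (V - {x, y, u})) x y v j {x, y, u} w
      * tri (T - (\<lambda>w. {w, y, u}) ` (V - {x, y, u})) w x u
     = paths T x y v j {x, y, u} w * tri T w x u" if "w \<in> V - {x, y, u}" for T w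
  proof (rule arg_cong2[where f = "(*)"], rule path_sum_cong, intro conjI)
    fix a b assume ab: "a \<in> V - {x, y, u} \<union> {w}" "b \<in> V - insert w {x, y, u}"
    have z: "u \<notin> {x, a, b}" "u \<notin> {y, a, b}" using ab True that by auto
    show "tri (T - (\<lambda>w. {w, y, u}) ` (V - {x, y, u})) x a b = tri T x a b"
      "tri (T - (\<lambda>w. {w, y, u}) ` (V - {x, y, u})) y a b = tri T y a b"
      using z by (intro tri_Diff; blast)+
  next
    have "y \<notin> {w, x, u}" using True that by auto
    then show "tri (T - (\<lambda>w. {w, y, u}) ` (V - {x, y, u})) w x u = tri T w x u"
      by (intro tri_Diff) blast
  qed simp
  have nn: "0 \<le> paths T x y v j {x, y, u} w" for T w by (rule path_sum_nonneg) simp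
  have "measure_pmf.prob \<P> (bad_paths2 j x y u v) \<le> exp (- (1\<^sup>2 * p * (s * (2 * s) ^ j / p) / (4 * (2 * s) ^ j)))"
    by (rule order_trans[OF measure_pmf.finite_measure_mono random_subset_upper_tail[OF
          finite_all_triangles p0 p1 tri_family[OF xy(2,3) yu, of "V - {x, y, u}"],
          where a = "\<lambda>T w. paths T x y v j {x, y, u} w * tri T w x u" and d = 1 and L = "s * (2 * s) ^ j / p" and M = "(2 * s) ^ j"]])
      (use s indep nn in \<open>auto simp: bad_paths2_def tri_def[of _ _ y u]\<close>)
  also have "\<dots> \<le> exp (- e)" using e s p by simp
  finally show ?thesis .
qed (auto simp: bad_paths2_def)

lemma prob_bad_closing:
  "x \<in> V \<Longrightarrow> y \<in> V \<Longrightarrow> z \<in> V \<Longrightarrow> measure_pmf.prob \<P> (bad_closing x y z) \<le> exp (- e)"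
proof (cases "distinct [x, y, z]")
  case True
  assume xy: "x \<in> V" "y \<in> V" "z \<in> V"
  have ne: "x \<noteq> y" using True by simp
  \<comment> \<open>A triangle crossed by a path contains only one of \<open>x\<close> and
    \<open>y\<close>; an exposed closing triangle contains both.\<close>
  have indep: "paths (T - (\<lambda>w. {w, x, y}) ` (V - {x, y})) x y v k {x, y} z
     = paths T x y v k {x, y} z" for T v
  proof (rule path_sum_cong, intro conjI)
    fix a b assume ab: "a \<in> V - {x, y} \<union> {z}" "b \<in> V - insert z {x, y}"
    have z: "y \<notin> {x, a, b}" "x \<notin> {y, a, b}" using ab True by auto
    show "tri (T - (\<lambda>w. {w, x, y}) ` (V - {x, y})) x a b = tri T x a b"
      "tri (T - (\<lambda>w. {w, x, y}) ` (V - {x, y})) y a b = tri T y a b"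
      using z by (intro tri_Diff; blast)+
  qed simp
  have nn: "0 \<le> paths T x y v k {x, y} z" for T v by (rule path_sum_nonneg) simp
  have "measure_pmf.prob \<P> (bad_closing x y z) \<le> exp (- ((1 / 2)\<^sup>2 * p * (d0 ^ k) / (4 * (2 * s) ^ k)))"
    by (rule order_trans[OF measure_pmf.finite_measure_mono random_subset_lower_tail[OF
          finite_all_triangles p0 p1 tri_family[OF xy(1,2) ne, of "V - {x, y}"],
          where a = "\<lambda>T w. paths T x y w k {x, y} z" and d = "1 / 2" and L = "d0 ^ k" and M = "(2 * s) ^ k"]])
      (use s indep nn in \<open>auto simp: bad_closing_def tri_def[of _ _ x y]\<close>)
  also have "\<dots> \<le> exp (- e)" using e by (simp add: power2_eq_square)
  finally show ?thesis .
qed (auto simp: bad_closing_def)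

definition bad :: "nat set set set" where
  "bad = (\<Union>(x, y, u, v)\<in>V \<times> V \<times> V \<times> V. bad_degree_high x y \<union> bad_degree_low x y
     \<union> bad_codegree_low x y u \<union> bad_closing x y u
     \<union> (\<Union>i\<in>{..<k}. bad_load i x y u \<union> bad_paths1 i x y u v \<union> bad_paths2 i x y u v))"

lemma prob_bad: "measure_pmf.prob \<P> bad \<le> real n ^ 4 * ((4 + 3 * real k) * exp (- e))"
proof -
  have "measure_pmf.prob \<P> bad \<le> real (card (V \<times> V \<times> V \<times> V)) * ((4 + 3 * real k) * exp (- e))"
    unfolding bad_def
  proof (rule measure_pmf_UN_le, simp)
    fix q assume "q \<in> V \<times> V \<times> V \<times> V"
    then obtain x y u v where q: "q = (x, y, u, v)" and V: "x \<in> V" "y \<in> V" "u \<in> V" "v \<in> V" by blast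
    have "measure_pmf.prob \<P> (\<Union>i\<in>{..<k}. bad_load i x y u \<union> bad_paths1 i x y u v \<union> bad_paths2 i x y u v)
        \<le> real (card {..<k}) * (exp (- e) + exp (- e) + exp (- e))"
      using V by (intro measure_pmf_UN_le measure_pmf_Un_le prob_bad_load prob_bad_paths1 prob_bad_paths2) auto
    then have "measure_pmf.prob \<P> (bad_degree_high x y \<union> bad_degree_low x y
     \<union> bad_codegree_low x y u \<union> bad_closing x y u
     \<union> (\<Union>i\<in>{..<k}. bad_load i x y u \<union> bad_paths1 i x y u v \<union> bad_paths2 i x y u v))
     \<le> exp (- e) + exp (- e) + exp (- e) + exp (- e) + real (card {..<k}) * (exp (- e) + exp (- e) + exp (- e))"
      using V by (intro measure_pmf_Un_le prob_bad_degree_high prob_bad_degree_low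
          prob_bad_codegree_low prob_bad_closing)
    then show "measure_pmf.prob \<P> (case q of (x, y, u, v) \<Rightarrow> bad_degree_high x y \<union> bad_degree_low x y
     \<union> bad_codegree_low x y u \<union> bad_closing x y u
     \<union> (\<Union>i\<in>{..<k}. bad_load i x y u \<union> bad_paths1 i x y u v \<union> bad_paths2 i x y u v))
     \<le> (4 + 3 * real k) * exp (- e)"
      by (simp add: q algebra_simps)
  qed
  then show ?thesis by (simp add: power4_eq_xxxx)
qed

section \<open>Deterministic bounds outside the bad events\<close>

context
  fixes T :: "nat set set"
  assumes T: "T \<subseteq> all_triangles n" and good: "T \<notin> bad"
begin

lemma not_bad:
  assumes "x \<in> V" "y \<in> V"
  shows "T \<notin> bad_degree_high x y" "T \<notin> bad_degree_low x y"
    and "u \<in> V \<Longrightarrow> T \<notin> bad_codegree_low x y u" "u \<in> V \<Longrightarrow> T \<notin> bad_closing x y u"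
    and "u \<in> V \<Longrightarrow> i < k \<Longrightarrow> T \<notin> bad_load i x y u"
    and "u \<in> V \<Longrightarrow> v \<in> V \<Longrightarrow> i < k \<Longrightarrow> T \<notin> bad_paths1 i x y u v"
    and "u \<in> V \<Longrightarrow> v \<in> V \<Longrightarrow> i < k \<Longrightarrow> T \<notin> bad_paths2 i x y u v"
proof -
  have *: "T \<notin> bad_degree_high x y \<union> bad_degree_low x y \<union> bad_codegree_low x y u \<union> bad_closing x y u
     \<union> (\<Union>i\<in>{..<k}. bad_load i x y u \<union> bad_paths1 i x y u v \<union> bad_paths2 i x y u v)"
    if "u \<in> V" "v \<in> V" for u v
  proof -
    let ?B = "\<lambda>(x, y, u, v). bad_degree_high x y \<union> bad_degree_low x y \<union> bad_codegree_low x y u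
       \<union> bad_closing x y u
       \<union> (\<Union>i\<in>{..<k}. bad_load i x y u \<union> bad_paths1 i x y u v \<union> bad_paths2 i x y u v)"
    have "?B (x, y, u, v) \<subseteq> bad"
      unfolding bad_def by (rule UN_upper) (use assms that in simp)
    then show ?thesis using good unfolding prod.case by (rule contra_subsetD)
  qed
  have **: "(T \<notin> bad_degree_high x y \<and> T \<notin> bad_degree_low x y) \<and>
      (T \<notin> bad_codegree_low x y u \<and> T \<notin> bad_closing x y u) \<and>
      (\<forall>i<k. T \<notin> bad_load i x y u \<and> T \<notin> bad_paths1 i x y u v \<and> T \<notin> bad_paths2 i x y u v)"
    if "u \<in> V" "v \<in> V" for u v
    using *[OF that] by (simp only: Un_iff UN_iff lessThan_iff de_Morgan_disj) simp
  show "T \<notin> bad_degree_high x y" "T \<notin> bad_degree_low x y"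
    using **[OF assms] by simp_all
  show "T \<notin> bad_codegree_low x y u" if "u \<in> V" using **[OF that that] by simp
  show "T \<notin> bad_closing x y u" if "u \<in> V" using **[OF that that] by simp
  show "T \<notin> bad_load i x y u" if "u \<in> V" "i < k" using **[OF that(1,1)] that(2) by simp
  show "T \<notin> bad_paths1 i x y u v" if "u \<in> V" "v \<in> V" "i < k" using **[OF that(1,2)] that(3) by simp
  show "T \<notin> bad_paths2 i x y u v" if "u \<in> V" "v \<in> V" "i < k" using **[OF that(1,2)] that(3) by simp
qed

lemma tri_eq_0: "\<not> distinct [x, y, z] \<Longrightarrow> tri T x y z = 0"
  using tri_distinct[of T x y z] card_all_triangles[OF T] by auto

lemma degree_bounds:
  assumes "x \<in> V" "y \<in> V" "x \<noteq> y"
  shows "(\<Sum>z\<in>V. tri T x y z) \<le> D1" "(1 - d) * p * (real n - 2) \<le> (\<Sum>z\<in>V. tri T x y z)"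
proof -
  have "(\<Sum>z\<in>V. tri T x y z) = (\<Sum>z\<in>V - {x, y}. tri T x y z)"
    by (intro sum.mono_neutral_right) (auto simp: tri_eq_0)
  also have "\<dots> = (\<Sum>z\<in>V - {x, y}. tri T z x y)"
    by (intro sum.cong refl tri_rotate[symmetric])
  finally show "(\<Sum>z\<in>V. tri T x y z) \<le> D1" "(1 - d) * p * (real n - 2) \<le> (\<Sum>z\<in>V. tri T x y z)"
    using not_bad(1,2)[OF assms(1,2)] assms(3)
    by (auto simp: bad_degree_high_def bad_degree_low_def D1)
qed

lemma closed_path_sum_nonneg: "0 \<le> closed_path_sum V T x y i A z"
  by (rule path_sum_nonneg) simp

text \<open>Outside \<open>bad_load\<close> it suffices to bound the single weights by
  \<open>D ^ i\<close> and their sum by \<open>D1 * D ^ i\<close>. The weights need degrees at most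
  \<open>D\<close>, which is the case 0 of the claim; the sum uses the case
  \<open>i - 1\<close>.\<close>

lemma load_le:
  assumes "i < k" "{x, z, u} \<subseteq> V" "distinct [x, z, u]"
  shows "(\<Sum>y\<in>V. tri T y z u * closed_path_sum V T x y i {x, y, z} u) \<le> D ^ Suc i"
  using assms
proof (induction i arbitrary: x z u rule: less_induct)
  case (less i)
  let ?Q = "closed_path_sum V T"
  let ?U = "V - {x, z, u}"
  have weight: "?Q x y i {x, y, z} u \<le> D ^ i" if y: "y \<in> ?U" for y
  proof (cases "i = 0")
    case False
    have deg: "(\<Sum>w\<in>V. tri T x v w * tri T y v w) \<le> D" if v: "v \<in> V - {x, y}" for v
    proof -
      have "(\<Sum>w\<in>V. tri T w x v * ?Q y w 0 {y, w, x} v) \<le> D ^ Suc 0"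
        using less.prems y v False by (intro less.IH) auto
      also have "(\<Sum>w\<in>V. tri T w x v * ?Q y w 0 {y, w, x} v) = (\<Sum>w\<in>V. tri T x v w * tri T y v w)"
        by (intro sum.cong refl) (simp add: tri_def insert_commute)
      finally show ?thesis by simp
    qed
    show ?thesis
    proof (rule path_sum_le[where B = "{x, y}", OF _ D_nonneg _ _ deg])
      show "u \<in> V - {x, y}" using y less.prems by auto
    qed auto
  qed simp
  have total: "(\<Sum>y\<in>?U. ?Q x y i {x, y, z} u) \<le> D1 * D ^ i"
  proof (cases i)
    case 0
    have "(\<Sum>y\<in>?U. ?Q x y i {x, y, z} u) = (\<Sum>y\<in>?U. tri T x u y)"
      unfolding 0 path_sum.simps by (intro sum.cong refl) (simp add: tri_def insert_commute)
    also have "\<dots> \<le> (\<Sum>y\<in>V. tri T x u y)"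
      by (intro sum_mono2) auto
    also have "\<dots> \<le> D1" using less.prems by (intro degree_bounds) auto
    finally show ?thesis by (simp add: 0)
  next
    \<comment> \<open>After splitting off the first step \<open>u v\<close>, the sum over
      \<open>y\<close> is the load of level \<open>j\<close> at \<open>x u v\<close>, and at most
      \<open>D1\<close> vertices \<open>v\<close> have \<open>x u v\<close> in
      \<open>T\<close>.\<close>
    case (Suc j)
    have "(\<Sum>y\<in>?U. ?Q x y i {x, y, z} u)
       \<le> (\<Sum>y\<in>V. \<Sum>v\<in>V. tri T x u v * (tri T y u v * ?Q x y j {x, y, u} v))"
    proof (rule sum_le_included[where i = "\<lambda>y. y"])
      show "\<forall>y\<in>?U. \<exists>y'\<in>V. y' = y \<and> ?Q x y i {x, y, z} u
          \<le> (\<Sum>v\<in>V. tri T x u v * (tri T y' u v * ?Q x y' j {x, y', u} v))"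
      proof (intro ballI bexI conjI refl)
        fix y assume y: "y \<in> ?U"
        have "?Q x y i {x, y, z} u \<le> ?Q x y i {x, y} u"
          by (rule path_sum_antimono) auto
        also have "\<dots> = (\<Sum>v\<in>V - {x, y, u}. tri T x u v * (tri T y u v * ?Q x y j {x, y, u} v))"
          using less.prems by (simp add: Suc mult.assoc insert_commute)
        also have "\<dots> \<le> (\<Sum>v\<in>V. tri T x u v * (tri T y u v * ?Q x y j {x, y, u} v))"
          by (intro sum_mono2 mult_nonneg_nonneg tri_nonneg closed_path_sum_nonneg) auto
        finally show "?Q x y i {x, y, z} u \<le> (\<Sum>v\<in>V. tri T x u v * (tri T y u v * ?Q x y j {x, y, u} v))" .
      qed auto
    qed (auto intro!: sum_nonneg mult_nonneg_nonneg path_sum_nonneg)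
    also have "\<dots> = (\<Sum>v\<in>V. tri T x u v * (\<Sum>y\<in>V. tri T y u v * ?Q x y j {x, y, u} v))"
      by (subst sum.swap) (simp add: sum_distrib_left)
    also have "\<dots> \<le> (\<Sum>v\<in>V. tri T x u v * D ^ i)"
    proof (intro sum_mono)
      fix v assume v: "v \<in> V"
      show "tri T x u v * (\<Sum>y\<in>V. tri T y u v * ?Q x y j {x, y, u} v) \<le> tri T x u v * D ^ i"
      proof (cases "distinct [x, u, v]")
        case True
        then show ?thesis
          unfolding Suc using less.prems v by (intro mult_left_mono less.IH) (auto simp: Suc)
      qed (simp add: tri_eq_0 del: distinct.simps)
    qed
    also have "\<dots> = (\<Sum>v\<in>V. tri T x u v) * D ^ i"
      by (simp only: sum_distrib_right)
    also have "\<dots> \<le> D1 * D ^ i"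
      using less.prems D_nonneg by (intro mult_right_mono degree_bounds) auto
    finally show ?thesis .
  qed
  \<comment> \<open>For \<open>y = x\<close> the closing triangle degenerates, for the other omitted
    \<open>y\<close> the triangle \<open>y z u\<close> does.\<close>
  have "(\<Sum>y\<in>V. tri T y z u * ?Q x y i {x, y, z} u) = (\<Sum>y\<in>?U. tri T y z u * ?Q x y i {x, y, z} u)"
  proof (intro sum.mono_neutral_right ballI)
    fix y assume "y \<in> V - ?U"
    then have "y = x \<or> y = z \<or> y = u" by auto
    then show "tri T y z u * ?Q x y i {x, y, z} u = 0"
      using closed_path_sum_eq_0[OF card_all_triangles[OF T], of T V x i] by (auto simp: tri_eq_0)
  qed auto
  also have "\<dots> = (\<Sum>y\<in>?U. ?Q x y i {x, y, z} u * tri T y z u)"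
    by (simp add: mult.commute)
  also have "(\<Sum>y\<in>?U. ?Q x y i {x, y, z} u * tri T y z u) < (1 + d) * p * (D1 * D ^ i)"
  proof (rule ccontr)
    assume "\<not> ?thesis"
    then have "(1 + d) * p * (D1 * D ^ i) \<le> (\<Sum>y\<in>?U. ?Q x y i {x, y, z} u * tri T y z u)"
      by (rule leI)
    with less.prems(3) weight total have "T \<in> bad_load i x z u"
      unfolding bad_load_def by blast
    then show False using not_bad(5)[of x z u i] less.prems(1,2) by blast
  qed
  also have "\<dots> = D ^ Suc i" by (simp add: D)
  finally show ?case by simp
qed

text \<open>The upper bound is the load of level 0. For the lower one, omitting \<open>w = y\<close>
  from the degree loses at most 1, hence the \<open>- 1\<close> in \<open>L2\<close>.\<close>

lemma codegree_bounds:
  assumes "{x, y, v} \<subseteq> V" "distinct [x, y, v]"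
  shows "(\<Sum>w\<in>V. tri T x v w * tri T y v w) \<le> D"
    and "d0 + real (k + 2) \<le> (\<Sum>w\<in>V. tri T x v w * tri T y v w)"
proof -
  have eq: "tri T w y v = tri T y v w" "tri T x w v = tri T x v w" for w
    by (auto simp: tri_def insert_commute)
  have "(\<Sum>w\<in>V. tri T w y v * closed_path_sum V T x w 0 {x, w, y} v) \<le> D ^ Suc 0"
    using assms k by (intro load_le) auto
  then show "(\<Sum>w\<in>V. tri T x v w * tri T y v w) \<le> D"
    by (simp add: eq mult.commute)
  let ?U = "V - {x, y, v}"
  have "(1 - d) * p * (real n - 2) \<le> (\<Sum>w\<in>V. tri T x v w)"
    using assms by (intro degree_bounds) auto
  also have "\<dots> = (\<Sum>w\<in>insert y ?U. tri T x v w)"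
    using assms by (intro sum.mono_neutral_right) (auto simp: tri_eq_0)
  also have "\<dots> = tri T x v y + (\<Sum>w\<in>?U. tri T x v w)"
    by (subst sum.insert) auto
  also have "\<dots> \<le> 1 + (\<Sum>w\<in>?U. tri T x v w)" by simp
  finally have "L2 \<le> (\<Sum>w\<in>?U. tri T x v w)" by (simp add: L2)
  then have "(1 - d) * p * L2 < (\<Sum>w\<in>?U. tri T x v w * tri T y v w)"
    using not_bad(3)[of x y v] assms by (auto simp: bad_codegree_low_def eq)
  also have "\<dots> \<le> (\<Sum>w\<in>V. tri T x v w * tri T y v w)"
    by (intro sum_mono2) auto
  finally show "d0 + real (k + 2) \<le> (\<Sum>w\<in>V. tri T x v w * tri T y v w)" using d0 by simp
qed

lemma paths_nonneg: "0 \<le> paths T x y v j A u"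
  by (rule path_sum_nonneg) simp

text \<open>Counted backwards from \<open>v\<close>, the paths after the first step number at most
  \<open>D ^ j\<close>, which \<open>short\<close> bounds by \<open>s * (2 * s) ^ j / p\<close>. The
  two exposures of the triangles at the first step then bring this down to
  \<open>(2 * s) ^ Suc j\<close>.\<close>

lemma paths_le:
  assumes "j \<le> k" "{x, y, u, v} \<subseteq> V" "distinct [x, y, u]"
  shows "paths T x y v j {x, y} u \<le> (2 * s) ^ j"
  using assms
proof (induction j arbitrary: u)
  case (Suc j)
  let ?U = "V - {x, y, u}"
  let ?W = "\<lambda>w. paths T x y v j {x, y, u} w"
  have weight: "?W w \<le> (2 * s) ^ j" if "w \<in> ?U" for w
  proof -
    have "?W w \<le> paths T x y v j {x, y} w" by (rule path_sum_antimono) auto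
    also have "\<dots> \<le> (2 * s) ^ j" using that Suc.prems by (intro Suc.IH) auto
    finally show ?thesis .
  qed
  have "(\<Sum>w\<in>?U. ?W w) \<le> D ^ j"
  proof (rule sum_path_sum_endpoint_le[where B = "{x, y}"])
    show "(\<Sum>w\<in>V. tri T x a w * tri T y a w) \<le> D" if "a \<in> V - {x, y}" for a
      using that Suc.prems by (intro codegree_bounds) auto
  qed (use Suc.prems D_nonneg in auto)
  also have "\<dots> \<le> s * (2 * s) ^ j / p"
    using short[of j] Suc.prems p by (simp add: field_simps)
  finally have total: "(\<Sum>w\<in>?U. ?W w) \<le> s * (2 * s) ^ j / p" .
  have V: "x \<in> V" "y \<in> V" "u \<in> V" "v \<in> V" and j: "j < k" using Suc.prems by auto
  have "(\<Sum>w\<in>?U. ?W w * tri T w x u) \<le> 2 * s * (2 * s) ^ j"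
    using not_bad(6)[OF V(1,2,3,4) j] total weight Suc.prems p by (auto simp: bad_paths1_def)
  \<comment> \<open>\<open>p \<le> 1 / 2\<close> weakens the bound to the shape that
    \<open>bad_paths2\<close> requires.\<close>
  also have "\<dots> \<le> 1 / p * (s * (2 * s) ^ j)"
  proof -
    have "2 * (s * (2 * s) ^ j) \<le> 1 / p * (s * (2 * s) ^ j)"
      using p s by (intro mult_right_mono) (auto simp: field_simps)
    then show ?thesis by (simp add: mult.assoc)
  qed
  finally have total2: "(\<Sum>w\<in>?U. ?W w * tri T w x u) \<le> s * (2 * s) ^ j / p" by simp
  have weight2: "?W w * tri T w x u \<le> (2 * s) ^ j" if "w \<in> ?U" for w
    using weight[OF that] paths_nonneg[of x y v j "{x, y, u}" w] by (auto simp: tri_def)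
  have "paths T x y v (Suc j) {x, y} u = (\<Sum>w\<in>?U. ?W w * tri T w x u * tri T w y u)"
    unfolding path_sum.simps
    by (intro sum.cong) (auto simp: tri_def insert_commute)
  also have "\<dots> \<le> (2 * s) ^ Suc j"
    using not_bad(7)[OF V(1,2,3,4) j] total2 weight2 Suc.prems p by (auto simp: bad_paths2_def)
  finally show ?case .
qed simp

text \<open>There are at least \<open>d0 ^ k\<close> paths, at most \<open>(2 * s) ^ k\<close> per
  endpoint, so no endpoint dominates; outside \<open>bad_closing\<close> at least half of the
  expected share \<open>p\<close> closes up.\<close>

lemma closed_path_sum_ge:
  assumes "{x, y, z} \<subseteq> V" "distinct [x, y, z]"
  shows "p * d0 ^ k / 2 \<le> closed_path_sum V T x y k {x, y} z"
proof -
  let ?W = "\<lambda>w. paths T x y w k {x, y} z"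
  have weight: "?W w \<le> (2 * s) ^ k" if "w \<in> V - {x, y}" for w
    using that assms by (intro paths_le) auto
  have "d0 ^ k \<le> path_sum V T x y (\<lambda>_. 1) k {x, y} z"
  \<comment> \<open>\<open>k + 2\<close> accounts for \<open>x\<close>, \<open>y\<close> and up to
    \<open>k\<close> visited vertices.\<close>
  proof (rule path_sum_ge[where B = "{x, y}" and m = "k + 2"])
    show "d0 + real (k + 2) \<le> (\<Sum>w\<in>V. tri T x a w * tri T y a w)" if "a \<in> V - {x, y}" for a
      using that assms by (intro codegree_bounds) auto
  qed (use d0 assms in \<open>auto simp: card_insert_if\<close>)
  also have "\<dots> = (\<Sum>w\<in>V - {x, y}. ?W w)"
    using assms by (subst path_sum_expand[where B = "{x, y}"]) auto
  finally have "(1 - 1 / 2) * p * d0 ^ k < (\<Sum>w\<in>V - {x, y}. ?W w * tri T w x y)"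
    using not_bad(4)[of x y z] weight assms by (auto simp: bad_closing_def)
  also have "\<dots> = (\<Sum>w\<in>V - {x, y}. ?W w * tri T x y w)"
    by (simp add: tri_def insert_commute)
  also have "\<dots> = closed_path_sum V T x y k {x, y} z"
    using assms by (subst path_sum_expand[where B = "{x, y}" and g = "tri T x y"]) auto
  finally show ?thesis by simp
qed

lemma h1_Sym_ge_good:
  assumes c: "0 < c" and d0_pos: "0 < d0"
    and bound: "4 * c * (1 + d) * real (2 * k + 1) * D ^ k \<le> d0 ^ k"
  shows "ereal c \<le> h1_Sym (complete_skeleton n \<union> T)"
proof -
  have n: "0 < n"
  proof (rule ccontr)
    assume "\<not> 0 < n"
    moreover have dp: "0 \<le> (1 - d) * p" using p d by simp
    ultimately have "L2 \<le> 0" by (simp add: L2)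
    then have "(1 - d) * p * L2 \<le> 0" using dp by (intro mult_nonneg_nonpos)
    then show False using d0 by linarith
  qed
  show ?thesis
  proof (rule h1_Sym_ge[OF T refl n c _ load_le D_nonneg D1_nonneg closed_path_sum_ge])
    show "0 < p * d0 ^ k / 2" using p d0_pos by simp
    have "(p * real n / 2) * (4 * c * (1 + d) * real (2 * k + 1) * D ^ k) \<le> (p * real n / 2) * d0 ^ k"
      using bound p by (intro mult_left_mono) auto
    then show "c * (2 * D1 * (real (2 * k + 1) * D ^ k)) \<le> real n * (p * d0 ^ k / 2)"
      by (simp add: D1 algebra_simps)
  qed (use degree_bounds in auto)
qed

end

lemma prob_h1_Sym_ge:
  assumes "0 < c" "0 < d0" "4 * c * (1 + d) * real (2 * k + 1) * D ^ k \<le> d0 ^ k"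
  shows "1 - real n ^ 4 * ((4 + 3 * real k) * exp (- e))
    \<le> measure_pmf.prob (linial_meshulam n p) {Y. ereal c \<le> h1_Sym Y}"
proof -
  have "1 - measure_pmf.prob \<P> bad = measure_pmf.prob \<P> (- bad)"
    using measure_pmf.prob_compl[of bad \<P>] by (simp add: Compl_eq_Diff_UNIV)
  also have "\<dots> \<le> measure_pmf.prob \<P> {T. ereal c \<le> h1_Sym (complete_skeleton n \<union> T)}"
  proof (rule measure_pmf.finite_measure_mono_AE)
    have "T \<in> - bad \<longrightarrow> T \<in> {T. ereal c \<le> h1_Sym (complete_skeleton n \<union> T)}" if "T \<in> set_pmf \<P>" for T
      using h1_Sym_ge_good[of T c] assms that by (auto simp: random_subset_def)
    then show "AE T in measure_pmf \<P>. T \<in> - bad \<longrightarrow> T \<in> {T. ereal c \<le> h1_Sym (complete_skeleton n \<union> T)}"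
      by (simp add: AE_measure_pmf_iff)
  qed simp
  also have "\<dots> = measure_pmf.prob (linial_meshulam n p) {Y. ereal c \<le> h1_Sym Y}"
    by (simp add: linial_meshulam_def random_subset_def vimage_def)
  finally show ?thesis using prob_bad by linarith
qed

end

section \<open>Asymptotics\<close>

text \<open>Compares \<open>D ^ k\<close> with \<open>d0 ^ k\<close>. A deviation of order
  \<open>1 / k\<close> keeps \<open>(1 - d) ^ (5 * k)\<close> above \<open>7 / 12\<close> by
  Bernoulli, and \<open>(1 - d) * (1 + d) \<le> 1\<close> absorbs the powers of
  \<open>1 + d\<close>.\<close>

lemma one_minus_power_bounds:
  fixes k :: nat
  assumes "0 < k"
  defines "d \<equiv> 1 / (12 * real k)"
  shows "0 < d" "d \<le> 1 / 12" "2 / 7 * ((1 + d)\<^sup>2) ^ k \<le> ((1 - d) ^ 3) ^ k"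
proof -
  show d: "0 < d" "d \<le> 1 / 12" using assms by (auto simp: field_simps)
  have "2 / 7 \<le> 1 + real (5 * k) * (- d)" using assms(1) by (simp add: d_def)
  also have "\<dots> \<le> (1 + (- d)) ^ (5 * k)" using d by (intro Bernoulli_inequality) simp
  finally have "2 / 7 * (1 + d) ^ (2 * k) \<le> (1 - d) ^ (5 * k) * (1 + d) ^ (2 * k)"
    using d by (intro mult_right_mono) auto
  also have "\<dots> = (1 - d) ^ (3 * k) * ((1 - d) * (1 + d)) ^ (2 * k)"
    by (simp add: power_mult_distrib mult_ac flip: power_add)
  also have "\<dots> \<le> (1 - d) ^ (3 * k) * 1"
    using d by (intro mult_left_mono power_le_one) (auto simp: algebra_simps mult_le_one)
  finally show "2 / 7 * ((1 + d)\<^sup>2) ^ k \<le> ((1 - d) ^ 3) ^ k" by (simp add: power_mult)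
qed

theorem theorem1p3:
  fixes \<eta> :: real
  assumes "0 < \<eta>" "\<eta> < 1 / 2"
  shows "(\<lambda>n. measure_pmf.prob (linial_meshulam n (real n powr (- 1 / 2 + \<eta>)))
            {Y. h1_Sym Y \<ge> ereal (\<eta> / 42)}) \<longlonglongrightarrow> 1"
proof -
  \<comment> \<open>As \<open>p * (n * p^2) ^ k = n powr ((2 * k + 1) * \<eta> - 1 / 2)\<close>,
    this is the least length for which the number of closing paths grows.\<close>
  define k where "k = (LEAST k. 1 / 2 < real (2 * k + 1) * \<eta>)"
  obtain m where "1 / 2 < real m * \<eta>" using reals_Archimedean3[OF assms(1)] by blast
  also have "real m * \<eta> \<le> real (2 * m + 1) * \<eta>" using assms by (intro mult_right_mono) auto
  finally have k_gt: "1 / 2 < real (2 * k + 1) * \<eta>" unfolding k_def by (rule LeastI)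
  have k0: "0 < k" using k_gt assms by (cases k) auto
  \<comment> \<open>For shorter lengths this exponent is not positive, so \<open>p * D ^ j\<close>
    stays bounded, as \<open>short\<close> needs.\<close>
  have k_le: "real (2 * j + 1) * \<eta> \<le> 1 / 2" if "j < k" for j
    using not_less_Least[of j "\<lambda>k. 1 / 2 < real (2 * k + 1) * \<eta>"] that by (simp add: k_def)
  define d where "d = 1 / (12 * real k)"
  note d_bounds = one_minus_power_bounds[OF k0, folded d_def]
  define c where "c = real (2 * k + 1) * \<eta> - 1 / 2"
  \<comment> \<open>Since \<open>(k + 1) * \<theta> = c / 2\<close>, the product of
    \<open>n powr \<theta>\<close> and \<open>(2 * s n) ^ k\<close> has order
    \<open>n powr (c / 2)\<close>, below the order \<open>n powr c\<close> of
    \<open>p n * d0 n ^ k\<close>.\<close>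
  define \<theta> where "\<theta> = c / (2 * real (k + 1))"
  have c0: "0 < c" and \<theta>0: "0 < \<theta>" using k_gt by (auto simp: c_def \<theta>_def)
  have c_le: "c \<le> 2 * \<eta>"
    using k_le[of "k - 1"] k0 by (simp add: c_def algebra_simps)
  have "\<theta> \<le> c / 2" unfolding \<theta>_def using c0 k0 by (intro divide_left_mono) auto
  then have \<theta>_lt: "\<theta> < 2 * \<eta>" using c_le c0 by linarith
  define p where "p n = real n powr (- 1 / 2 + \<eta>)" for n
  \<comment> \<open>The 4 makes \<open>s n / 4\<close> equal to the tail exponent
    \<open>n powr \<theta>\<close>.\<close>
  define s where "s n = 4 * real n powr \<theta>" for n
  \<comment> \<open>Two factors \<open>1 - d\<close> are lost to degrees and codegrees; the third
    leaves a margin for the lower-order terms.\<close>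
  define d0 where "d0 n = (1 - d) ^ 3 * real n powr (2 * \<eta>)" for n
  have ev: "\<forall>\<^sub>F n in sequentially. p n \<le> 1 / 2"
    "\<forall>\<^sub>F n in sequentially. real k + 3 \<le> (1 - d)\<^sup>2 * d * real n powr (2 * \<eta>)"
    "\<forall>\<^sub>F n in sequentially. real n powr \<theta> \<le> d\<^sup>2 * (1 - d) ^ 3 / 4 * real n powr (2 * \<eta>)"
    "\<forall>\<^sub>F n in sequentially. 16 * 8 ^ k * real n powr (c / 2) \<le> ((1 - d) ^ 3) ^ k * real n powr c"
  proof -
    have d': "0 < 1 - d" using d_bounds by simp
    have pos: "0 < (1 - d)\<^sup>2 * d" "0 < d\<^sup>2 * (1 - d) ^ 3 / 4" "0 < ((1 - d) ^ 3) ^ k" "0 < (16 * 8 ^ k :: real)"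
      using d_bounds d' by simp_all
    show "\<forall>\<^sub>F n in sequentially. p n \<le> 1 / 2"
      unfolding p_def using assms by real_asymp
    show "\<forall>\<^sub>F n in sequentially. real k + 3 \<le> (1 - d)\<^sup>2 * d * real n powr (2 * \<eta>)"
      using assms pos(1) by real_asymp
    show "\<forall>\<^sub>F n in sequentially. real n powr \<theta> \<le> d\<^sup>2 * (1 - d) ^ 3 / 4 * real n powr (2 * \<eta>)"
      using \<theta>_lt pos(2) \<theta>0 by real_asymp
    define a b where "a = (16 * 8 ^ k :: real)" and "b = ((1 - d) ^ 3) ^ k"
    have "\<forall>\<^sub>F n in sequentially. a * real n powr (c / 2) \<le> b * real n powr c"
      using c0 pos(3,4) unfolding a_def[symmetric] b_def[symmetric] by real_asymp
    then show "\<forall>\<^sub>F n in sequentially. 16 * 8 ^ k * real n powr (c / 2) \<le> ((1 - d) ^ 3) ^ k * real n powr c"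
      by (simp add: a_def b_def)
  qed
  have lower: "\<forall>\<^sub>F n in sequentially. 1 - real n ^ 4 * ((4 + 3 * real k) * exp (- (real n powr \<theta>)))
      \<le> measure_pmf.prob (linial_meshulam n (p n)) {Y. ereal (\<eta> / 42) \<le> h1_Sym Y}"
    using ev eventually_gt_at_top[of 0]
  proof eventually_elim
    case (elim n)
    let ?N = "real n"
    have N: "1 \<le> ?N" using elim by simp
    have p0: "0 < p n" using N by (simp add: p_def)
    have np: "p n * p n * ?N = ?N powr (2 * \<eta>)"
    proof -
      have "p n * p n * ?N = ?N powr (- 1 / 2 + \<eta>) * ?N powr (- 1 / 2 + \<eta>) * ?N powr 1"
        using N by (simp add: p_def)
      also have "\<dots> = ?N powr ((- 1 / 2 + \<eta>) + (- 1 / 2 + \<eta>) + 1)"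
        by (simp only: powr_add)
      finally show ?thesis by simp
    qed
    have pow: "p n * (?N powr (2 * \<eta>)) ^ j = ?N powr (real (2 * j + 1) * \<eta> - 1 / 2)" for j
      using N by (simp add: p_def powr_power flip: powr_add) (simp add: algebra_simps)
    define D where "D = (1 + d) * p n * ((1 + d) * p n * ?N)"
    define L where "L = (1 - d) * p n * (?N - 2) - 1"
    have D_eq: "D = (1 + d)\<^sup>2 * ?N powr (2 * \<eta>)"
      unfolding np[symmetric] by (simp add: D_def power2_eq_square mult_ac)
    have d0: "d0 n + real (k + 2) \<le> (1 - d) * p n * L"
    proof -
      have "(1 - d) * p n * L = (1 - d)\<^sup>2 * (p n * p n * ?N) - 2 * ((1 - d)\<^sup>2 * (p n * p n)) - (1 - d) * p n"
        by (simp add: L_def algebra_simps power2_eq_square)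
      \<comment> \<open>The corrections from \<open>- 2\<close> and \<open>- 1\<close> in
        \<open>L\<close> total at most 1, whence \<open>k + 3\<close> in the margin instead of
        \<open>k + 2\<close>.\<close>
      moreover have "(1 - d)\<^sup>2 * (p n * p n) \<le> 1 * (1 / 2 * (1 / 2))"
        using d_bounds p0 elim by (intro mult_mono power_le_one) auto
      moreover have "(1 - d) * p n \<le> 1 * (1 / 2)"
        using d_bounds p0 elim by (intro mult_mono) auto
      moreover have "(1 - d)\<^sup>2 * ?N powr (2 * \<eta>) = d0 n + (1 - d)\<^sup>2 * d * ?N powr (2 * \<eta>)"
        by (simp add: d0_def algebra_simps power2_eq_square power3_eq_cube)
      ultimately show ?thesis using elim(2) unfolding np by simp
    qed
    have d0_pos: "0 < d0 n" using d_bounds N by (simp add: d0_def)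
    have pL: "d0 n \<le> p n * L"
    proof -
      have "0 < (1 - d) * (p n * L)" using d0 d0_pos by (simp add: mult.assoc)
      then have "0 < p n * L" using d_bounds by (simp add: zero_less_mult_iff)
      then have "(1 - d) * (p n * L) \<le> 1 * (p n * L)" using d_bounds by (intro mult_right_mono) auto
      then show ?thesis using d0 by (simp add: mult.assoc)
    qed
    interpret random_complex n k "p n" d "s n" "?N powr \<theta>" "d0 n" "(1 + d) * p n * ?N" D L
    proof
      show "0 < p n" "p n \<le> 1 / 2" "0 < d" "d \<le> 1" "0 < k" using p0 elim d_bounds k0 by auto
      have "1 \<le> ?N powr \<theta>" using N \<theta>0 by (intro ge_one_powr_ge_zero) auto
      then show "1 \<le> s n" by (simp add: s_def)
      show "0 \<le> d0 n" using d0_pos by simp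
      show "d0 n + real (k + 2) \<le> (1 - d) * p n * L" by (rule d0)
      show "p n * D ^ j \<le> s n * (2 * s n) ^ j" if "j < k" for j
      proof -
        have "?N powr (real (2 * j + 1) * \<eta> - 1 / 2) \<le> ?N powr 0"
          using N k_le[OF that] by (intro powr_mono) auto
        then have le_1: "?N powr (real (2 * j + 1) * \<eta> - 1 / 2) \<le> 1" using N by simp
        have "p n * D ^ j = ((1 + d)\<^sup>2) ^ j * (p n * (?N powr (2 * \<eta>)) ^ j)"
          by (simp add: D_eq power_mult_distrib)
        also have "\<dots> \<le> (2\<^sup>2) ^ j * 1"
          unfolding pow using d_bounds by (intro mult_mono power_mono le_1) auto
        also have "\<dots> \<le> 1 * (2 * s n) ^ j"
          using power_mono[of 4 "2 * s n" j] \<open>1 \<le> ?N powr \<theta>\<close> by (simp add: s_def)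
        also have "\<dots> \<le> s n * (2 * s n) ^ j"
          using \<open>1 \<le> s n\<close> by (intro mult_right_mono) auto
        finally show ?thesis .
      qed
      have "d\<^sup>2 / 4 * d0 n \<le> d\<^sup>2 / 4 * (p n * L)" using pL by (intro mult_left_mono) auto
      then show "?N powr \<theta> \<le> d\<^sup>2 * p n * L / 4"
        using elim(3) by (simp add: d0_def mult_ac)
      show "?N powr \<theta> \<le> s n / 4" by (simp add: s_def)
      have "?N powr \<theta> * (16 * (2 * s n) ^ k) = 16 * 8 ^ k * ?N powr (c / 2)"
      proof -
        have "c / (2 * r) * r = c / 2" if "r \<noteq> 0" for r :: real using that by simp
        then have "\<theta> * real (k + 1) = c / 2" unfolding \<theta>_def by (metis of_nat_0_eq_iff add_is_0 one_neq_zero)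
        then have "\<theta> + real k * \<theta> = c / 2" by (simp add: distrib_left mult.commute)
        then have "?N powr \<theta> * (?N powr \<theta>) ^ k = ?N powr (c / 2)"
          using N by (simp add: powr_power del: eq_divide_eq_numeral1 flip: powr_add)
        then show ?thesis by (simp add: s_def power_mult_distrib mult_ac)
      qed
      also have "\<dots> \<le> ((1 - d) ^ 3) ^ k * ?N powr c" using elim(4) .
      also have "\<dots> = p n * d0 n ^ k"
        using pow[of k] by (simp add: d0_def power_mult_distrib c_def mult_ac)
      finally show "?N powr \<theta> \<le> p n * d0 n ^ k / (16 * (2 * s n) ^ k)"
        using \<open>1 \<le> s n\<close> by (simp add: pos_le_divide_eq)
    qed (auto simp: D_def L_def)
    show ?case
    proof (rule prob_h1_Sym_ge)
      \<comment> \<open>Minimality of \<open>k\<close> gives \<open>c \<le> 2 * \<eta> < 1\<close>,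
        so \<open>(2 * k + 1) * \<eta> \<le> 3 / 2\<close>. With \<open>1 + d \<le> 2\<close> the
        constant 42 leads to the \<open>2 / 7\<close> of
        \<open>one_minus_power_bounds\<close>.\<close>
      have "4 * (\<eta> / 42) * (1 + d) * real (2 * k + 1) = 2 / 21 * (1 + d) * (c + 1 / 2)"
        by (simp add: c_def)
      also have "\<dots> \<le> 2 / 21 * 2 * (3 / 2)"
        using d_bounds c_le assms c0 by (intro mult_mono) auto
      finally have "4 * (\<eta> / 42) * (1 + d) * real (2 * k + 1) * D ^ k \<le> 2 / 7 * D ^ k"
        using zero_le_power[OF D_nonneg] by (intro mult_right_mono) auto
      also have "\<dots> = 2 / 7 * ((1 + d)\<^sup>2) ^ k * (?N powr (2 * \<eta>)) ^ k"
        by (simp add: D_eq power_mult_distrib)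
      also have "\<dots> \<le> ((1 - d) ^ 3) ^ k * (?N powr (2 * \<eta>)) ^ k"
        using d_bounds by (intro mult_right_mono) auto
      also have "\<dots> = d0 n ^ k" by (simp add: d0_def power_mult_distrib)
      finally show "4 * (\<eta> / 42) * (1 + d) * real (2 * k + 1) * D ^ k \<le> d0 n ^ k" .
    qed (use assms d0_pos in auto)
  qed
  have lim: "(\<lambda>n. 1 - real n ^ 4 * ((4 + 3 * real k) * exp (- (real n powr \<theta>)))) \<longlonglongrightarrow> 1"
    using \<theta>0 by real_asymp
  have "(\<lambda>n. measure_pmf.prob (linial_meshulam n (p n)) {Y. ereal (\<eta> / 42) \<le> h1_Sym Y}) \<longlonglongrightarrow> 1"
    by (rule tendsto_sandwich[OF lower _ lim tendsto_const]) simp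
  then show ?thesis by (simp add: p_def)
qed

end
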